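(* Let $(X,\Sigma,\mathfrak m)$ be a probability space and let $(\Omega,\mathsf d)$ be a compact metric space. Then each Radon $L^0$-valued measure $\mu\in\mathfrak M(\Omega;L^0(\mathfrak m))$ admits an $\mathfrak m$-a.e. unique foliation $(\mu_x)_{x\in X}\subseteq\mathfrak M(\Omega)$. Moreover, $(|\mu_x|)_{x\in X}$ is the $\mathfrak m$-a.e. unique foliation of $|\mu|$.
   Context: $L^0(\mathfrak m)$ is the algebra of $\mathfrak m$-a.e. equivalence classes $[f]_{\mathfrak m}$ of measurable functions $X\to\mathbb R$, with the $\mathfrak m$-a.e. order and the distance $\int|f-g|\wedge1\,\mathrm d\mathfrak m$; $L^0_+(\mathfrak m)$ is its positive cone; $\bar L^0(\mathfrak m)$ is the complete lattice of classes of $[-\infty,+\infty]$-valued measurable functions, in which $\bigvee,\bigwedge$ are taken. Functions on $X$ are $\mathfrak m$-measurable if they are measurable with respect to the $\mathfrak m$-completion of $\Sigma$; their classes are identified with elements of $L^0(\mathfrak m)$. A sequence in $L^0_+(\mathfrak m)$ is summable if its partial sums are order bounded in $L^0(\mathfrak m)$. A (Borel) $L^0$-valued measure is a map $\mu\colon\mathscr B(\Omega)\to L^0(\mathfrak m)$ with $\mu(\varnothing)=0$ such that for pairwise disjoint Borel sets $(A_n)$ the sequence $(|\mu(A_n)|)_n$ is summable and $\mu(\bigcup_nA_n)=\sum_n\mu(A_n)$ (limit in $L^0(\mathfrak m)$). Its total variation is $|\mu|(A)=\bigvee\{\sum_n|\mu(A_n)|:(A_n)_{n\in\mathbb N}\text{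 Borel partition of }A\}$; it is of bounded variation if $|\mu|(\Omega)\in L^0_+(\mathfrak m)$, and then $|\mu|$ is again an $L^0$-valued measure. An $L^0$-valued measure of bounded variation is Radon if $|\mu|(U)=\bigvee\{|\mu|(K):K\subseteq U\text{ compact}\}$ for all open $U$ and $|\mu|(B)=\bigwedge\{|\mu|(U):U\text{ open},\,B\subseteq U\}$ for all Borel $B$; the space of these is $\mathfrak M(\Omega;L^0(\mathfrak m))$. $\mathfrak M(\Omega)$ is the Banach space of finite signed (real-valued) Radon measures on $\Omega$, and $|\mu_x|$ is the total variation measure of $\mu_x\in\mathfrak M(\Omega)$. A foliation of an $L^0$-valued measure $\mu$ of bounded variation is a family $(\mu_x)_{x\in X}$ of finite signed Borel measures on $\Omega$ such that for every $A\in\mathscr B(\Omega)$ the function $x\mapsto\mu_x(A)$ is $\mathfrak m$-measurable and $\mu(A)=[\mu_\cdot(A)]_{\mathfrak m}$. $\mathfrak m$-a.e. unique means that any two foliations $(\mu_x)$, $(\nu_x)$ satisfy $\mu_x=\nu_x$ for $\mathfrak m$-a.e. $x\in X$. *)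

theory Defs
  imports "HOL-Probability.Probability" "HOL-Algebra.Lattice"
begin

section \<open>The spaces of a.e. equivalence classes\<close>

text \<open>
  The class of \<open>f\<close> consists of the \<open>M\<close>-measurable functions that agree with \<open>f\<close> almost
  everywhere. The function \<open>f\<close> itself need only be measurable with respect to the completion
  of \<open>M\<close>: its class is then the element of \<open>L\<^sup>0\<close> with which it is identified.
\<close>

definition ae_class :: "'x measure \<Rightarrow> ('x \<Rightarrow> 'b::topological_space) \<Rightarrow> ('x \<Rightarrow> 'b) set" where
  "ae_class M f = {g \<in> borel_measurable M. AE x in M. g x = f x}"

definition L0 :: "'x measure \<Rightarrow> ('x \<Rightarrow> 'b::topological_space) set set" where
  "L0 M = ae_class M ` borel_measurable M"

text \<open>
  The operations on classes are defined through a chosen representative; none of them depends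
  on the choice.
\<close>

definition L0_rep :: "('x \<Rightarrow> 'b) set \<Rightarrow> 'x \<Rightarrow> 'b" where
  "L0_rep F = (SOME f. f \<in> F)"

definition L0_le :: "'x measure \<Rightarrow> ('x \<Rightarrow> 'b::ord) set \<Rightarrow> ('x \<Rightarrow> 'b) set \<Rightarrow> bool" where
  "L0_le M F G \<longleftrightarrow> (AE x in M. L0_rep F x \<le> L0_rep G x)"

definition L0_zero :: "'x measure \<Rightarrow> ('x \<Rightarrow> real) set" where
  "L0_zero M = ae_class M (\<lambda>x. 0)"

definition L0_pos :: "'x measure \<Rightarrow> ('x \<Rightarrow> real) set set" where
  "L0_pos M = {F \<in> L0 M. L0_le M (L0_zero M) F}"

definition L0_abs :: "'x measure \<Rightarrow> ('x \<Rightarrow> real) set \<Rightarrow> ('x \<Rightarrow> real) set" where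
  "L0_abs M F = ae_class M (\<lambda>x. \<bar>L0_rep F x\<bar>)"

definition L0_dist :: "'x measure \<Rightarrow> ('x \<Rightarrow> real) set \<Rightarrow> ('x \<Rightarrow> real) set \<Rightarrow> real" where
  "L0_dist M F G = (\<integral>x. min \<bar>L0_rep F x - L0_rep G x\<bar> 1 \<partial>M)"

definition L0_partial_sum :: "'x measure \<Rightarrow> (nat \<Rightarrow> ('x \<Rightarrow> real) set) \<Rightarrow> nat \<Rightarrow> ('x \<Rightarrow> real) set" where
  "L0_partial_sum M F n = ae_class M (\<lambda>x. \<Sum>i<n. L0_rep (F i) x)"

definition L0_summable :: "'x measure \<Rightarrow> (nat \<Rightarrow> ('x \<Rightarrow> real) set) \<Rightarrow> bool" where
  "L0_summable M F \<longleftrightarrow> (\<exists>B\<in>L0 M. \<forall>n. L0_le M (L0_partial_sum M F n) B)"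

definition L0_sums :: "'x measure \<Rightarrow> (nat \<Rightarrow> ('x \<Rightarrow> real) set) \<Rightarrow> ('x \<Rightarrow> real) set \<Rightarrow> bool" where
  "L0_sums M F S \<longleftrightarrow> S \<in> L0 M \<and> (\<lambda>n. L0_dist M (L0_partial_sum M F n) S) \<longlonglongrightarrow> 0"

definition L0_bar :: "'x measure \<Rightarrow> ('x \<Rightarrow> ereal) set gorder" where
  "L0_bar M = \<lparr>carrier = L0 M, eq = (=), le = L0_le M\<rparr>"

definition L0_to_bar :: "'x measure \<Rightarrow> ('x \<Rightarrow> real) set \<Rightarrow> ('x \<Rightarrow> ereal) set" where
  "L0_to_bar M F = ae_class M (\<lambda>x. ereal (L0_rep F x))"

text \<open>Inverse to \<^const>\<open>L0_to_bar\<close> on its range; meaningless elsewhere.\<close>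

definition L0_of_bar :: "'x measure \<Rightarrow> ('x \<Rightarrow> ereal) set \<Rightarrow> ('x \<Rightarrow> real) set" where
  "L0_of_bar M F = ae_class M (\<lambda>x. real_of_ereal (L0_rep F x))"


section \<open>Measures with values in \<open>L\<^sup>0\<close>\<close>

text \<open>
  The metric space is a subset \<open>\<Omega>\<close> of a type of class \<^class>\<open>metric_space\<close> with the restricted
  metric. Set functions are HOL-total, but only their values on Borel subsets of \<open>\<Omega>\<close> matter.
\<close>

abbreviation borel_on :: "'o::topological_space set \<Rightarrow> 'o measure" where
  "borel_on \<Omega> \<equiv> restrict_space borel \<Omega>"

definition borel_partitions :: "'o::topological_space set \<Rightarrow> 'o set \<Rightarrow> (nat \<Rightarrow> 'o set) set" where
  "borel_partitions \<Omega> A =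
     {P. range P \<subseteq> sets (borel_on \<Omega>) \<and> disjoint_family P \<and> (\<Union>n. P n) = A}"

definition L0_valued_measure ::
  "'x measure \<Rightarrow> 'o::topological_space set \<Rightarrow> ('o set \<Rightarrow> ('x \<Rightarrow> real) set) \<Rightarrow> bool" where
  "L0_valued_measure M \<Omega> \<mu> \<longleftrightarrow>
     (\<forall>A\<in>sets (borel_on \<Omega>). \<mu> A \<in> L0 M) \<and>
     \<mu> {} = L0_zero M \<and>
     (\<forall>A. range A \<subseteq> sets (borel_on \<Omega>) \<and> disjoint_family A \<longrightarrow>
        L0_summable M (\<lambda>n. L0_abs M (\<mu> (A n))) \<and>
        L0_sums M (\<lambda>n. \<mu> (A n)) (\<mu> (\<Union>n. A n)))"

definition L0_variation_bar ::
  "'x measure \<Rightarrow> 'o::topological_space set \<Rightarrow> ('o set \<Rightarrow> ('x \<Rightarrow> real) set) \<Rightarrow>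
     'o set \<Rightarrow> ('x \<Rightarrow> ereal) set" where
  "L0_variation_bar M \<Omega> \<mu> A =
     \<Squnion>\<^bsub>L0_bar M\<^esub> {L0_to_bar M S | S. \<exists>P\<in>borel_partitions \<Omega> A. L0_sums M (\<lambda>n. L0_abs M (\<mu> (P n))) S}"

definition L0_bounded_variation ::
  "'x measure \<Rightarrow> 'o::topological_space set \<Rightarrow> ('o set \<Rightarrow> ('x \<Rightarrow> real) set) \<Rightarrow> bool" where
  "L0_bounded_variation M \<Omega> \<mu> \<longleftrightarrow> L0_variation_bar M \<Omega> \<mu> \<Omega> \<in> L0_to_bar M ` L0_pos M"

text \<open>The total variation as an \<open>L\<^sup>0\<close>-valued set function, for \<open>\<mu>\<close> of bounded variation.\<close>

definition L0_variation ::
  "'x measure \<Rightarrow> 'o::topological_space set \<Rightarrow> ('o set \<Rightarrow> ('x \<Rightarrow> real) set) \<Rightarrow>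
     'o set \<Rightarrow> ('x \<Rightarrow> real) set" where
  "L0_variation M \<Omega> \<mu> A = L0_of_bar M (L0_variation_bar M \<Omega> \<mu> A)"

definition L0_Radon_measures ::
  "'x measure \<Rightarrow> 'o::topological_space set \<Rightarrow> ('o set \<Rightarrow> ('x \<Rightarrow> real) set) set" where
  "L0_Radon_measures M \<Omega> =
     {\<mu>. L0_valued_measure M \<Omega> \<mu> \<and> L0_bounded_variation M \<Omega> \<mu> \<and>
         (\<forall>U. openin (top_of_set \<Omega>) U \<longrightarrow>
            L0_variation_bar M \<Omega> \<mu> U =
              \<Squnion>\<^bsub>L0_bar M\<^esub> {L0_variation_bar M \<Omega> \<mu> K | K. compact K \<and> K \<subseteq> U}) \<and>
         (\<forall>B\<in>sets (borel_on \<Omega>).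
            L0_variation_bar M \<Omega> \<mu> B =
              \<Sqinter>\<^bsub>L0_bar M\<^esub> {L0_variation_bar M \<Omega> \<mu> U | U. openin (top_of_set \<Omega>) U \<and> B \<subseteq> U})}"


section \<open>Finite signed measures\<close>

definition finite_signed_measure :: "'o::topological_space set \<Rightarrow> ('o set \<Rightarrow> real) \<Rightarrow> bool" where
  "finite_signed_measure \<Omega> \<nu> \<longleftrightarrow>
     \<nu> {} = 0 \<and>
     (\<forall>A. range A \<subseteq> sets (borel_on \<Omega>) \<and> disjoint_family A \<longrightarrow>
        (\<lambda>n. \<nu> (A n)) sums \<nu> (\<Union>n. A n))"

definition signed_variation_ennreal ::
  "'o::topological_space set \<Rightarrow> ('o set \<Rightarrow> real) \<Rightarrow> 'o set \<Rightarrow> ennreal" where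
  "signed_variation_ennreal \<Omega> \<nu> A = (SUP P\<in>borel_partitions \<Omega> A. \<Sum>n. ennreal \<bar>\<nu> (P n)\<bar>)"

text \<open>
  The variation of a finite signed measure is finite, so that \<^const>\<open>enn2real\<close> loses nothing.
\<close>

definition signed_variation ::
  "'o::topological_space set \<Rightarrow> ('o set \<Rightarrow> real) \<Rightarrow> 'o set \<Rightarrow> real" where
  "signed_variation \<Omega> \<nu> A = enn2real (signed_variation_ennreal \<Omega> \<nu> A)"

definition Radon_measures :: "'o::topological_space set \<Rightarrow> ('o set \<Rightarrow> real) set" where
  "Radon_measures \<Omega> =
     {\<nu>. finite_signed_measure \<Omega> \<nu> \<and>
         (\<forall>U. openin (top_of_set \<Omega>) U \<longrightarrow>
            signed_variation_ennreal \<Omega> \<nu> U =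
              (SUP K\<in>{K. compact K \<and> K \<subseteq> U}. signed_variation_ennreal \<Omega> \<nu> K)) \<and>
         (\<forall>B\<in>sets (borel_on \<Omega>).
            signed_variation_ennreal \<Omega> \<nu> B =
              (INF U\<in>{U. openin (top_of_set \<Omega>) U \<and> B \<subseteq> U}. signed_variation_ennreal \<Omega> \<nu> U))}"


section \<open>Foliations\<close>

definition foliation ::
  "'x measure \<Rightarrow> 'o::topological_space set \<Rightarrow> ('o set \<Rightarrow> ('x \<Rightarrow> real) set) \<Rightarrow>
     ('x \<Rightarrow> 'o set \<Rightarrow> real) \<Rightarrow> bool" where
  "foliation M \<Omega> \<mu> \<kappa> \<longleftrightarrow>
     (\<forall>x\<in>space M. finite_signed_measure \<Omega> (\<kappa> x)) \<and>
     (\<forall>A\<in>sets (borel_on \<Omega>).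
        (\<lambda>x. \<kappa> x A) \<in> borel_measurable (completion M) \<and> \<mu> A = ae_class M (\<lambda>x. \<kappa> x A))"

definition ae_unique_foliation ::
  "'x measure \<Rightarrow> 'o::topological_space set \<Rightarrow> ('o set \<Rightarrow> ('x \<Rightarrow> real) set) \<Rightarrow> bool" where
  "ae_unique_foliation M \<Omega> \<mu> \<longleftrightarrow>
     (\<forall>\<kappa> \<kappa>'. foliation M \<Omega> \<mu> \<kappa> \<and> foliation M \<Omega> \<mu> \<kappa>' \<longrightarrow>
        (AE x in M. \<forall>A\<in>sets (borel_on \<Omega>). \<kappa> x A = \<kappa>' x A))"

end

theory Submission
  imports Defs
begin

text \<open>
  Choose representatives of \<open>\<mu>(A)\<close> for the sets \<open>A\<close> of a countable algebra generating the Borel sets: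
  outside a null set of \<open>x\<close> they form a finitely additive function bounded by \<open>|\<mu>|(\<Omega>)(x)\<close>. Countable
  additivity is obtained by transport to Cantor space: there is a Borel map \<open>\<Phi>\<close> from \<open>\<Omega>\<close> to Cantor space
  with a Borel left inverse \<open>\<Psi>\<close>, and on Cantor space a bounded finitely additive function on the
  clopen cylinders splits into its upper and lower variations, which extend to measures by
  compactness and Caratheodory's theorem. The image of the extension under \<open>\<Psi>\<close> is \<open>\<mu>\<^sub>x\<close>.

  For the variation, a Hahn set of \<open>\<mu>\<^sub>x\<close> can be approximated from the countable algebra, so that
  \<open>|\<mu>\<^sub>x|(A)\<close> is the supremum over the countably many \<open>B\<close> of
  \<open>|\<mu>\<^sub>x(A \<inter> B)| + |\<mu>\<^sub>x(A - B)|\<close>; this identifies its class with the supremum in the lattice.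
\<close>

section \<open>Signed measures and their variation\<close>

text \<open>Every identity satisfied by the representatives holds only off a null set that depends
  on the sets involved, so only countably many identities can be imposed at one \<open>x\<close>.
  Finite additivity on a countable algebra consists of countably many of them, countable additivity
  does not: there are uncountably many sequences. Hence countable additivity must follow from finite
  additivity alone, and this is what Cantor space provides. The bound at each \<open>x\<close> is
  indispensable too, since a finitely additive real function with unbounded values has no finite
  upper variation. The topology of \<open>\<Omega>\<close> is not transported: the coding is only
  Borel, and what counts is that every Borel set \<open>A\<close> is the preimage under
  \<open>\<Phi>\<close>, within \<open>\<Omega>\<close>, of its own preimage under
  \<open>\<Psi>\<close>. A Dynkin induction carries the agreement with \<open>\<mu>\<close> from the
  cylinders to all measurable subsets of Cantor space.\<close>

locale bounded_content = ring_of_sets \<Omega> \<A> for \<Omega> :: "'a set" and \<A> +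
  fixes f :: "'a set \<Rightarrow> real" and C :: real
  assumes add: "A \<in> \<A> \<Longrightarrow> B \<in> \<A> \<Longrightarrow> A \<inter> B = {} \<Longrightarrow> f (A \<union> B) = f A + f B"
    and bounded: "A \<in> \<A> \<Longrightarrow> \<bar>f A\<bar> \<le> C"
begin

text \<open>The positive part in the Jordan decomposition of \<open>f\<close>; the negative part is
  \<open>upper_variation - f\<close>. It is formed twice, on the Borel sets of
  \<open>\<Omega>\<close> and on the cylinders of Cantor space.\<close>

definition upper_variation :: "'a set \<Rightarrow> real" where
  "upper_variation A = (SUP B\<in>{B\<in>\<A>. B \<subseteq> A}. f B)"

lemma empty: "f {} = 0"
  using add[of "{}" "{}"] by simp

lemma bdd_above_values: "bdd_above (f ` {B\<in>\<A>. B \<subseteq> A})"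
  using bounded by (intro bdd_aboveI2[of _ _ C]) (auto simp: abs_le_iff)

lemma le_upper_variation: "B \<in> \<A> \<Longrightarrow> B \<subseteq> A \<Longrightarrow> f B \<le> upper_variation A"
  unfolding upper_variation_def by (intro cSUP_upper bdd_above_values) auto

lemma upper_variation_le:
  "(\<And>B. B \<in> \<A> \<Longrightarrow> B \<subseteq> A \<Longrightarrow> f B \<le> c) \<Longrightarrow> upper_variation A \<le> c"
  unfolding upper_variation_def by (intro cSUP_least) auto

lemma upper_variation_nonneg: "0 \<le> upper_variation A"
  using le_upper_variation[of "{}" A] empty by simp

lemma upper_variation_empty: "upper_variation {} = 0"
  using upper_variation_le[of "{}" 0] upper_variation_nonneg[of "{}"] empty by force

lemma upper_variation_mono: "A \<subseteq> B \<Longrightarrow> upper_variation A \<le> upper_variation B"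
  by (intro upper_variation_le le_upper_variation) auto

lemma upper_variation_add:
  assumes A: "A \<in> \<A>" and B: "B \<in> \<A>" and d: "A \<inter> B = {}"
  shows "upper_variation (A \<union> B) = upper_variation A + upper_variation B"
proof (rule antisym)
  show "upper_variation (A \<union> B) \<le> upper_variation A + upper_variation B"
  proof (rule upper_variation_le)
    fix D assume D: "D \<in> \<A>" "D \<subseteq> A \<union> B"
    have "f D = f ((D \<inter> A) \<union> (D \<inter> B))" using D by (intro arg_cong[where f=f]) auto
    also have "\<dots> = f (D \<inter> A) + f (D \<inter> B)" using D A B d by (intro add) auto
    also have "\<dots> \<le> upper_variation A + upper_variation B"
      using D A B by (intro add_mono le_upper_variation) auto
    finally show "f D \<le> upper_variation A + upper_variation B" .
  qed
  \<comment> \<open>The bound \<open>f D + f E \<le> upper_variation (A \<union> B)\<close> holds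
    for independent \<open>D\<close> and \<open>E\<close>; the supremum is taken over
    \<open>E\<close> with \<open>D\<close> fixed, and afterwards over \<open>D\<close>.\<close>
  have "upper_variation A \<le> upper_variation (A \<union> B) - upper_variation B"
  proof (rule upper_variation_le)
    fix D assume D: "D \<in> \<A>" "D \<subseteq> A"
    have "upper_variation B \<le> upper_variation (A \<union> B) - f D"
    proof (rule upper_variation_le)
      fix E assume E: "E \<in> \<A>" "E \<subseteq> B"
      have "f D + f E = f (D \<union> E)" using D E d by (intro add[symmetric]) auto
      also have "\<dots> \<le> upper_variation (A \<union> B)" using D E by (intro le_upper_variation) auto
      finally show "f E \<le> upper_variation (A \<union> B) - f D" by simp
    qed
    then show "f D \<le> upper_variation (A \<union> B) - upper_variation B" by simp
  qed
  then show "upper_variation A + upper_variation B \<le> upper_variation (A \<union> B)" by simp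
qed

lemma upper_variation_sum:
  fixes A :: "nat \<Rightarrow> 'a set"
  assumes "range A \<subseteq> \<A>" "disjoint_family A"
  shows "(\<Sum>i<n. upper_variation (A i)) = upper_variation (\<Union>i<n. A i)"
proof (induction n)
  case 0
  then show ?case by (simp add: upper_variation_empty)
next
  case (Suc n)
  have "(\<Union>i<n. A i) \<inter> A n = {}"
    using disjoint_family_onD[OF assms(2)] by (auto dest: less_imp_neq)
  moreover have "(\<Union>i<n. A i) \<in> \<A>" using assms(1) by (intro finite_UN) auto
  ultimately have "upper_variation ((\<Union>i<n. A i) \<union> A n) = upper_variation (\<Union>i<n. A i) + upper_variation (A n)"
    using assms(1) by (intro upper_variation_add) auto
  then show ?case using Suc by (simp add: lessThan_Suc Un_commute)
qed

text \<open>Finite additivity and monotonicity give one inequality. For the other, a competitor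
  \<open>B\<close> below the union is cut into the pieces \<open>B \<inter> A i\<close>, to which
  the countable additivity of \<open>f\<close> applies.\<close>

lemma upper_variation_sums:
  assumes sig: "\<And>A. range A \<subseteq> \<A> \<Longrightarrow> disjoint_family A \<Longrightarrow> (\<Union>i. A i) \<in> \<A> \<Longrightarrow>
      (\<lambda>i. f (A i)) sums f (\<Union>i. A i)"
    and A: "range A \<subseteq> \<A>" "disjoint_family A" "(\<Union>i. A i) \<in> \<A>"
  shows "(\<lambda>i. upper_variation (A i)) sums upper_variation (\<Union>i. A i)"
proof -
  have le: "(\<Sum>i<n. upper_variation (A i)) \<le> upper_variation (\<Union>i. A i)" for n
    unfolding upper_variation_sum[OF A(1,2)] by (intro upper_variation_mono) auto
  have summable: "summable (\<lambda>i. upper_variation (A i))"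
    by (intro summableI_nonneg_bounded[OF upper_variation_nonneg le])
  moreover have "(\<Sum>i. upper_variation (A i)) = upper_variation (\<Union>i. A i)"
  proof (rule antisym)
    show "(\<Sum>i. upper_variation (A i)) \<le> upper_variation (\<Union>i. A i)"
      using summable le by (intro suminf_le_const)
    show "upper_variation (\<Union>i. A i) \<le> (\<Sum>i. upper_variation (A i))"
    proof (rule upper_variation_le)
      fix B assume B: "B \<in> \<A>" "B \<subseteq> (\<Union>i. A i)"
      have *: "(\<Union>i. B \<inter> A i) = B" using B(2) by auto
      have s: "(\<lambda>i. f (B \<inter> A i)) sums f B"
        using sig[of "\<lambda>i. B \<inter> A i"] A B unfolding *
        by (auto simp: disjoint_family_on_def image_subset_iff)
      then have "f B = (\<Sum>i. f (B \<inter> A i))" by (simp add: sums_iff)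
      also have "\<dots> \<le> (\<Sum>i. upper_variation (A i))"
        using s summable A B
        by (intro suminf_le le_upper_variation) (auto simp: sums_iff)
      finally show "f B \<le> (\<Sum>i. upper_variation (A i))" .
    qed
  qed
  ultimately show ?thesis by (simp add: sums_iff)
qed

end

section \<open>Boundedness and Jordan decomposition of finite signed measures\<close>

lemma ex_finite_measure_of_sums:
  fixes g :: "'a set \<Rightarrow> real"
  assumes "sigma_algebra \<Omega> \<A>" "g {} = 0" "\<And>A. A \<in> \<A> \<Longrightarrow> 0 \<le> g A"
    and "\<And>A. range A \<subseteq> \<A> \<Longrightarrow> disjoint_family A \<Longrightarrow> (\<lambda>i. g (A i)) sums g (\<Union>i. A i)"
  shows "\<exists>m. finite_measure m \<and> space m = \<Omega> \<and> sets m = \<A> \<and> (\<forall>A\<in>\<A>. measure m A = g A)"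
proof -
  interpret sigma_algebra \<Omega> \<A> by fact
  let ?m = "measure_of \<Omega> \<A> (\<lambda>A. ennreal (g A))"
  have em: "emeasure ?m A = ennreal (g A)" if "A \<in> \<A>" for A
  proof (rule emeasure_measure_of_sigma[OF assms(1) _ _ that])
    show "positive \<A> (\<lambda>A. ennreal (g A))" using assms by (auto simp: positive_def)
    show "countably_additive \<A> (\<lambda>A. ennreal (g A))"
      unfolding countably_additive_def
    proof safe
      fix A :: "nat \<Rightarrow> 'a set"
      assume A: "range A \<subseteq> \<A>" "disjoint_family A"
      have "(\<lambda>i. ennreal (g (A i))) sums ennreal (g (\<Union>i. A i))"
        using A assms(3) by (subst sums_ennreal) (auto intro!: assms(4) assms(3))
      then show "(\<Sum>i. ennreal (g (A i))) = ennreal (g (\<Union>i. A i))" by (rule sums_unique[symmetric])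
    qed
  qed
  have "space ?m = \<Omega>" "sets ?m = \<A>" using space_closed by simp_all
  moreover have "finite_measure ?m"
    by (rule finite_measureI) (use em[OF top] calculation in simp)
  moreover have "measure ?m A = g A" if "A \<in> \<A>" for A
    using em[OF that] assms(3)[OF that] by (simp add: measure_def)
  ultimately show ?thesis by blast
qed

context
  fixes \<Omega> :: "'o::topological_space set" and \<nu> :: "'o set \<Rightarrow> real"
  assumes \<nu>: "finite_signed_measure \<Omega> \<nu>"
begin

lemma finite_signed_measure_empty: "\<nu> {} = 0"
  using \<nu> by (simp add: finite_signed_measure_def)

lemma finite_signed_measure_sums:
  "range A \<subseteq> sets (borel_on \<Omega>) \<Longrightarrow> disjoint_family A \<Longrightarrow> (\<lambda>n. \<nu> (A n)) sums \<nu> (\<Union>n. A n)"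
  using \<nu> by (simp add: finite_signed_measure_def)

lemma finite_signed_measure_Un:
  assumes "A \<in> sets (borel_on \<Omega>)" "B \<in> sets (borel_on \<Omega>)" "A \<inter> B = {}"
  shows "\<nu> (A \<union> B) = \<nu> A + \<nu> B"
proof -
  have "(\<lambda>n. \<nu> (binaryset A B n)) sums \<nu> (\<Union>n. binaryset A B n)"
    using assms by (intro finite_signed_measure_sums)
      (auto simp: binaryset_def disjoint_family_on_def)
  moreover have "(\<lambda>n. \<nu> (binaryset A B n)) sums (\<nu> A + \<nu> B)"
    by (rule binaryset_sums) (rule finite_signed_measure_empty)
  ultimately show ?thesis by (simp add: sums_iff UN_binaryset_eq)
qed

lemma finite_signed_measure_Diff:
  assumes "A \<in> sets (borel_on \<Omega>)" "B \<in> sets (borel_on \<Omega>)"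
  shows "\<nu> (A - B) = \<nu> A - \<nu> (A \<inter> B)"
proof -
  have "\<nu> ((A - B) \<union> (A \<inter> B)) = \<nu> (A - B) + \<nu> (A \<inter> B)"
    using assms by (intro finite_signed_measure_Un) auto
  then show ?thesis by (simp add: Un_Diff_Int)
qed

text \<open>
  If \<open>\<nu>\<close> were unbounded, one could split off from a set on which it is unbounded a piece of
  measure at least one in absolute value, leaving a set on which \<open>\<nu>\<close> is still unbounded.
\<close>

lemma finite_signed_measure_bounded:
  "\<exists>c. \<forall>A\<in>sets (borel_on \<Omega>). \<bar>\<nu> A\<bar> \<le> c"
proof (rule ccontr)
  let ?N = "borel_on \<Omega>"
  define unb where "unb E \<longleftrightarrow> (\<forall>c. \<exists>B\<in>sets ?N. B \<subseteq> E \<and> \<bar>\<nu> B\<bar> > c)" for E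
  assume *: "\<not> (\<exists>c. \<forall>A\<in>sets ?N. \<bar>\<nu> A\<bar> \<le> c)"
  have "unb (space ?N)"
    unfolding unb_def
  proof
    fix c
    obtain A where "A \<in> sets ?N" "\<not> \<bar>\<nu> A\<bar> \<le> c" using * by blast
    then show "\<exists>B\<in>sets ?N. B \<subseteq> space ?N \<and> \<bar>\<nu> B\<bar> > c"
      using sets.sets_into_space[of A ?N] by (intro bexI[of _ A]) (auto simp: not_le)
  qed
  then have start: "space ?N \<in> sets ?N \<and> unb (space ?N)" by auto
  have split: "\<exists>E'. (E' \<in> sets ?N \<and> unb E') \<and> E' \<subseteq> E \<and> 1 \<le> \<bar>\<nu> (E - E')\<bar>"
    if E: "E \<in> sets ?N \<and> unb E" for E
  proof -
    \<comment> \<open>The surplus 1 over \<open>\<bar>\<nu> E\<bar>\<close> makes both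
      \<open>\<bar>\<nu> B\<bar>\<close> and \<open>\<bar>\<nu> (E - B)\<bar>\<close> at least 1, so
      either part may be the one that is split off.\<close>
    obtain B where B: "B \<in> sets ?N" "B \<subseteq> E" "\<bar>\<nu> B\<bar> > \<bar>\<nu> E\<bar> + 1"
      using E unfolding unb_def by blast
    have d: "\<nu> (E - B) = \<nu> E - \<nu> B"
      using finite_signed_measure_Diff[of E B] E B by (simp add: Int_absorb1)
    have "unb B \<or> unb (E - B)"
    proof (rule ccontr)
      assume "\<not> (unb B \<or> unb (E - B))"
      then obtain c1 c2 where c: "\<And>D. D \<in> sets ?N \<Longrightarrow> D \<subseteq> B \<Longrightarrow> \<bar>\<nu> D\<bar> \<le> c1"
        "\<And>D. D \<in> sets ?N \<Longrightarrow> D \<subseteq> E - B \<Longrightarrow> \<bar>\<nu> D\<bar> \<le> c2"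
        unfolding unb_def by (meson not_less)
      obtain D where D: "D \<in> sets ?N" "D \<subseteq> E" "\<bar>\<nu> D\<bar> > c1 + c2" using E unfolding unb_def by blast
      have "\<bar>\<nu> (D \<inter> B)\<bar> \<le> c1" "\<bar>\<nu> (D - B)\<bar> \<le> c2" using D B by (auto intro!: c)
      then show False using D finite_signed_measure_Diff[of D B] B by linarith
    qed
    then show ?thesis
    proof
      assume "unb B"
      then show ?thesis using B d by (intro exI[of _ B]) auto
    next
      assume "unb (E - B)"
      moreover have "E - (E - B) = B" using B by auto
      ultimately show ?thesis using B E by (intro exI[of _ "E - B"]) auto
    qed
  qed
  obtain E where E: "\<And>n::nat. (E n \<in> sets ?N \<and> unb (E n)) \<and> E (Suc n) \<subseteq> E n \<and> 1 \<le> \<bar>\<nu> (E n - E (Suc n))\<bar>"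
    using dependent_nat_choice[of "\<lambda>_ E. E \<in> sets ?N \<and> unb E"
      "\<lambda>_ E E'. E' \<subseteq> E \<and> 1 \<le> \<bar>\<nu> (E - E')\<bar>"] start split by auto
  have dec: "decseq E" using E by (simp add: decseq_Suc_iff)
  have "disjoint_family (\<lambda>n. E n - E (Suc n))"
  proof -
    have "(E m - E (Suc m)) \<inter> (E n - E (Suc n)) = {}" if "m < n" for m n
      using decseqD[OF dec, of "Suc m" n] that by auto
    then show ?thesis unfolding disjoint_family_on_def
      by (metis Int_commute linorder_neqE_nat)
  qed
  \<comment> \<open>The terms of a convergent series tend to 0, whereas every piece has measure at
    least 1 in absolute value.\<close>
  then have "(\<lambda>n. \<nu> (E n - E (Suc n))) sums \<nu> (\<Union>n. E n - E (Suc n))"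
    using E by (intro finite_signed_measure_sums) auto
  then have "(\<lambda>n. \<nu> (E n - E (Suc n))) \<longlonglongrightarrow> 0"
    by (intro summable_LIMSEQ_zero) (simp add: sums_iff)
  then have "\<forall>\<^sub>F n in sequentially. \<bar>\<nu> (E n - E (Suc n))\<bar> < 1"
    by (auto simp: tendsto_iff dest: spec[of _ 1])
  then show False using E by (auto simp: eventually_sequentially not_less[symmetric])
qed

text \<open>Boundedness turns the upper variation into a finite measure. It dominates
  \<open>\<nu>\<close>, so what remains after subtracting \<open>\<nu>\<close> is a finite measure
  too.\<close>

lemma ex_Jordan_decomposition:
  "\<exists>m1 m2. finite_measure m1 \<and> finite_measure m2 \<and>
     sets m1 = sets (borel_on \<Omega>) \<and> sets m2 = sets (borel_on \<Omega>) \<and>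
     (\<forall>A\<in>sets (borel_on \<Omega>). \<nu> A = measure m1 A - measure m2 A)"
proof -
  let ?N = "borel_on \<Omega>"
  obtain c where c: "\<And>A. A \<in> sets ?N \<Longrightarrow> \<bar>\<nu> A\<bar> \<le> c" using finite_signed_measure_bounded by blast
  interpret bounded_content "space ?N" "sets ?N" \<nu> c
    by unfold_locales (auto simp: finite_signed_measure_Un c)
  have s: "(\<lambda>i. upper_variation (A i)) sums upper_variation (\<Union>i. A i)"
    if "range A \<subseteq> sets ?N" "disjoint_family A" for A
    using that by (intro upper_variation_sums finite_signed_measure_sums) auto
  obtain m1 where m1: "finite_measure m1" "space m1 = space ?N" "sets m1 = sets ?N"
    "\<And>A. A \<in> sets ?N \<Longrightarrow> measure m1 A = upper_variation A"
    using ex_finite_measure_of_sums[OF sets.sigma_algebra_axioms upper_variation_empty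
      upper_variation_nonneg s, of ?N] by auto
  have "\<exists>m2. finite_measure m2 \<and> space m2 = space ?N \<and> sets m2 = sets ?N \<and>
      (\<forall>A\<in>sets ?N. measure m2 A = upper_variation A - \<nu> A)"
    by (rule ex_finite_measure_of_sums[OF sets.sigma_algebra_axioms])
      (auto simp: upper_variation_empty empty le_upper_variation
        intro: sums_diff[OF s finite_signed_measure_sums])
  then obtain m2 where m2: "finite_measure m2" "space m2 = space ?N" "sets m2 = sets ?N"
    "\<And>A. A \<in> sets ?N \<Longrightarrow> measure m2 A = upper_variation A - \<nu> A" by auto
  show ?thesis
    by (intro exI[of _ m1] exI[of _ m2] conjI ballI m1(1,3) m2(1,3)) (simp add: m1(4) m2(4))
qed

end

section \<open>Borel sets of a subspace, variation measures and regularity\<close>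

lemma sets_borel_on_eq: "sets (borel_on \<Omega>) = sigma_sets \<Omega> {U. openin (top_of_set \<Omega>) U}"
proof -
  have "sets (borel_on \<Omega>) = {(\<lambda>x. x) -` A \<inter> \<Omega> | A. A \<in> sigma_sets UNIV {S. open S}}"
    by (auto simp: sets_restrict_space borel_def)
  also have "\<dots> = sigma_sets \<Omega> {(\<lambda>x. x) -` A \<inter> \<Omega> | A. A \<in> {S. open S}}"
    by (rule sigma_sets_vimage_commute) auto
  also have "{(\<lambda>x. x) -` A \<inter> \<Omega> | A. A \<in> {S. open S}} = {U. openin (top_of_set \<Omega>) U}"
    by (auto simp: openin_open)
  finally show ?thesis .
qed

lemma openin_sets_borel_on: "openin (top_of_set \<Omega>) U \<Longrightarrow> U \<in> sets (borel_on \<Omega>)"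
  by (auto simp: sets_borel_on_eq)

lemma compact_sets_borel_on:
  fixes \<Omega> :: "'o::t2_space set"
  assumes "compact K" "K \<subseteq> \<Omega>"
  shows "K \<in> sets (borel_on \<Omega>)"
proof -
  have "\<Omega> - K \<in> sets (borel_on \<Omega>)"
    using compact_imp_closed[OF assms(1)]
    by (intro openin_sets_borel_on) (auto simp: openin_open intro: exI[of _ "- K"])
  then have "space (borel_on \<Omega>) - (\<Omega> - K) \<in> sets (borel_on \<Omega>)" by (rule sets.compl_sets)
  also have "space (borel_on \<Omega>) - (\<Omega> - K) = K" using assms(2) by (auto simp: space_restrict_space)
  finally show ?thesis .
qed

text \<open>A Hahn set \<open>Y\<close> for two measures with difference \<open>\<nu>\<close> yields
  the partition of \<open>A\<close> into \<open>A \<inter> Y\<close> and \<open>A - Y\<close>, which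
  attains the supremum defining the variation. \<open>Y\<close> is part of the conclusion because
  its approximation later produces the countable formula for the variation.\<close>

lemma ex_variation_measure:
  assumes \<nu>: "finite_signed_measure \<Omega> \<nu>"
  shows "\<exists>m Y. finite_measure m \<and> sets m = sets (borel_on \<Omega>) \<and> Y \<in> sets (borel_on \<Omega>) \<and>
    (\<forall>A\<in>sets (borel_on \<Omega>). signed_variation_ennreal \<Omega> \<nu> A = emeasure m A \<and>
       measure m A = \<nu> (A \<inter> Y) - \<nu> (A - Y) \<and> \<bar>\<nu> A\<bar> \<le> measure m A)"
proof -
  let ?N = "borel_on \<Omega>"
  obtain m1 m2 where fin: "finite_measure m1" "finite_measure m2"
    and s: "sets m1 = sets ?N" "sets m2 = sets ?N"
    and eq: "\<And>A. A \<in> sets ?N \<Longrightarrow> \<nu> A = measure m1 A - measure m2 A"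
    using ex_Jordan_decomposition[OF \<nu>] by metis
  interpret m1: finite_measure m1 by fact
  interpret m2: finite_measure m2 by fact
  have s12: "sets m2 = sets m1" using s by simp
  obtain Y where Y: "Y \<in> sets ?N"
    and em: "\<forall>X\<in>sets ?N. X \<subseteq> Y \<longrightarrow> emeasure m2 X \<le> emeasure m1 X"
      "\<forall>X\<in>sets ?N. X \<inter> Y = {} \<longrightarrow> emeasure m1 X \<le> emeasure m2 X"
    using finite_unsigned_Hahn_decomposition[OF fin s12] unfolding s(1) by (elim bexE conjE)
  then have pos: "\<And>X. X \<in> sets ?N \<Longrightarrow> X \<subseteq> Y \<Longrightarrow> 0 \<le> \<nu> X"
    and neg: "\<And>X. X \<in> sets ?N \<Longrightarrow> X \<inter> Y = {} \<Longrightarrow> \<nu> X \<le> 0"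
    by (simp_all add: eq m1.emeasure_eq_measure m2.emeasure_eq_measure)
  define g where "g A = \<nu> (A \<inter> Y) - \<nu> (A - Y)" for A
  have g_nonneg: "0 \<le> g A" and g_abs: "g A = \<bar>\<nu> (A \<inter> Y)\<bar> + \<bar>\<nu> (A - Y)\<bar>" and g_ge: "\<bar>\<nu> A\<bar> \<le> g A"
    if A: "A \<in> sets ?N" for A
  proof -
    have "0 \<le> \<nu> (A \<inter> Y)" "\<nu> (A - Y) \<le> 0" using A Y by (auto intro!: pos neg)
    moreover have "\<nu> (A - Y) = \<nu> A - \<nu> (A \<inter> Y)" using finite_signed_measure_Diff[OF \<nu> A Y] .
    ultimately show "0 \<le> g A" "g A = \<bar>\<nu> (A \<inter> Y)\<bar> + \<bar>\<nu> (A - Y)\<bar>" "\<bar>\<nu> A\<bar> \<le> g A"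
      unfolding g_def by linarith+
  qed
  have g_sums: "(\<lambda>i. g (A i)) sums g (\<Union>i. A i)" if A: "range A \<subseteq> sets ?N" "disjoint_family A" for A
  proof -
    have "(\<lambda>i. \<nu> (A i \<inter> Y)) sums \<nu> (\<Union>i. A i \<inter> Y)"
      using A Y by (intro finite_signed_measure_sums[OF \<nu>]) (auto simp: disjoint_family_on_def)
    moreover have "(\<lambda>i. \<nu> (A i - Y)) sums \<nu> (\<Union>i. A i - Y)"
      using A Y by (intro finite_signed_measure_sums[OF \<nu>]) (auto simp: disjoint_family_on_def)
    ultimately have "(\<lambda>i. \<nu> (A i \<inter> Y) - \<nu> (A i - Y)) sums (\<nu> (\<Union>i. A i \<inter> Y) - \<nu> (\<Union>i. A i - Y))"
      by (rule sums_diff)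
    then show ?thesis by (simp add: g_def)
  qed
  have "\<exists>m. finite_measure m \<and> space m = space ?N \<and> sets m = sets ?N \<and> (\<forall>A\<in>sets ?N. measure m A = g A)"
    using g_nonneg g_sums by (intro ex_finite_measure_of_sums sets.sigma_algebra_axioms) (auto simp: g_def)
  then obtain m where m: "finite_measure m" "sets m = sets ?N" "\<And>A. A \<in> sets ?N \<Longrightarrow> measure m A = g A"
    by blast
  interpret m: finite_measure m by fact
  have "signed_variation_ennreal \<Omega> \<nu> A = emeasure m A" if A: "A \<in> sets ?N" for A
  proof (rule antisym)
    show "signed_variation_ennreal \<Omega> \<nu> A \<le> emeasure m A"
      unfolding signed_variation_ennreal_def
    proof (rule SUP_least)
      fix P assume P: "P \<in> borel_partitions \<Omega> A"
      have "(\<Sum>n. ennreal \<bar>\<nu> (P n)\<bar>) \<le> (\<Sum>n. emeasure m (P n))"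
        using P by (intro suminf_le) (auto simp: borel_partitions_def m.emeasure_eq_measure m(3) g_ge image_subset_iff intro!: ennreal_leI)
      also have "\<dots> = emeasure m (\<Union>n. P n)"
        using P by (intro suminf_emeasure) (auto simp: borel_partitions_def m(2))
      also have "(\<Union>n. P n) = A" using P by (simp add: borel_partitions_def)
      finally show "(\<Sum>n. ennreal \<bar>\<nu> (P n)\<bar>) \<le> emeasure m A" .
    qed
    let ?P = "binaryset (A \<inter> Y) (A - Y)"
    have P: "?P \<in> borel_partitions \<Omega> A"
      using A Y unfolding borel_partitions_def
      by (auto simp: binaryset_def disjoint_family_on_def split: if_splits)
    have "emeasure m A = ennreal \<bar>\<nu> (A \<inter> Y)\<bar> + ennreal \<bar>\<nu> (A - Y)\<bar>"
      using A by (simp add: m.emeasure_eq_measure m(3) g_abs)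
    also have "\<dots> = (\<Sum>n. ennreal \<bar>\<nu> (?P n)\<bar>)"
      by (intro suminf_binaryset_eq[symmetric]) (simp add: finite_signed_measure_empty[OF \<nu>])
    also have "\<dots> \<le> signed_variation_ennreal \<Omega> \<nu> A"
      unfolding signed_variation_ennreal_def using P by (rule SUP_upper)
    finally show "emeasure m A \<le> signed_variation_ennreal \<Omega> \<nu> A" .
  qed
  then show ?thesis using m Y g_ge
    by (intro exI[of _ m] exI[of _ Y]) (simp add: g_def)
qed

text \<open>The points whose distance to the complement of \<open>U\<close> is at least
  \<open>1/(n+1)\<close> form increasing compact sets; they exhaust \<open>U\<close> because the
  complement is closed.\<close>

lemma open_compact_approx:
  fixes \<Omega> :: "'o::metric_space set"
  assumes \<Omega>: "compact \<Omega>" and m: "finite_measure m" "sets m = sets (borel_on \<Omega>)"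
    and U: "openin (top_of_set \<Omega>) U"
  shows "\<exists>K::nat \<Rightarrow> 'o set. (\<forall>n. compact (K n) \<and> K n \<subseteq> U) \<and> (\<lambda>n. measure m (K n)) \<longlonglongrightarrow> measure m U"
\<comment> \<open>\<open>infdist\<close> to the empty set is 0 by convention, so for
  \<open>U = \<Omega>\<close> the sets \<open>K n\<close> used below would be empty.\<close>
proof (cases "U = \<Omega>")
  case True
  then show ?thesis using \<Omega> by (intro exI[of _ "\<lambda>_. \<Omega>"]) auto
next
  case False
  interpret finite_measure m by fact
  have U\<Omega>: "U \<subseteq> \<Omega>" using U openin_imp_subset by blast
  have ne: "\<Omega> - U \<noteq> {}" using False U\<Omega> by auto
  have "closedin (top_of_set \<Omega>) (\<Omega> - U)" using U by (simp add: closedin_diff)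
  then have "closed (\<Omega> - U)" using \<Omega> compact_imp_closed closedin_closed_trans by blast
  define K where "K n = {x\<in>\<Omega>. inverse (real (Suc n)) \<le> infdist x (\<Omega> - U)}" for n
  have K: "compact (K n)" for n
  proof -
    have "closed {x. inverse (real (Suc n)) \<le> infdist x (\<Omega> - U)}"
      by (intro closed_Collect_le continuous_intros)
    then have "compact (\<Omega> \<inter> {x. inverse (real (Suc n)) \<le> infdist x (\<Omega> - U)})"
      by (intro compact_Int_closed \<Omega>)
    then show ?thesis by (simp add: K_def Int_def)
  qed
  have KU: "K n \<subseteq> U" for n
  proof
    fix x assume x: "x \<in> K n"
    show "x \<in> U"
    proof (rule ccontr)
      assume "x \<notin> U"
      then have "infdist x (\<Omega> - U) = 0" using x by (intro infdist_zero) (auto simp: K_def)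
      moreover have "0 < inverse (real (Suc n))" by simp
      ultimately show False using x by (simp add: K_def del: of_nat_Suc)
    qed
  qed
  have "(\<Union>n. K n) = U"
  proof
    show "U \<subseteq> (\<Union>n. K n)"
    proof
      fix x assume x: "x \<in> U"
      have "infdist x (\<Omega> - U) > 0"
        using x ne \<open>closed (\<Omega> - U)\<close> by (intro infdist_pos_not_in_closed) auto
      then obtain n where "inverse (real (Suc n)) < infdist x (\<Omega> - U)" using reals_Archimedean by blast
      then show "x \<in> (\<Union>n. K n)" using x U\<Omega> by (auto simp: K_def intro!: exI[of _ n])
    qed
  qed (use KU in auto)
  moreover have "incseq K"
  proof (rule incseq_SucI)
    fix n
    have "inverse (real (Suc (Suc n))) \<le> inverse (real (Suc n))" by (intro le_imp_inverse_le) auto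
    then show "K n \<subseteq> K (Suc n)" unfolding K_def by (blast intro: order_trans)
  qed
  moreover have "range K \<subseteq> sets m"
    using K KU U\<Omega> by (auto simp: m(2) intro!: compact_sets_borel_on)
  ultimately have "(\<lambda>n. measure m (K n)) \<longlonglongrightarrow> measure m U"
    using finite_Lim_measure_incseq[of K] by simp
  then show ?thesis using K KU by blast
qed

text \<open>The sets that can be enclosed between a compact and an open set with arbitrarily small
  gap form a sigma-algebra. Approximating from both sides at once makes complements easy: they
  exchange the roles of \<open>K\<close> and \<open>U\<close> and keep the gap.\<close>

lemma compact_open_regular:
  fixes \<Omega> :: "'o::metric_space set"
  assumes \<Omega>: "compact \<Omega>" and m: "finite_measure m" "sets m = sets (borel_on \<Omega>)"
    and A: "A \<in> sets (borel_on \<Omega>)" and e: "0 < (e::real)"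
  shows "\<exists>K U. compact K \<and> openin (top_of_set \<Omega>) U \<and> K \<subseteq> A \<and> A \<subseteq> U \<and> measure m (U - K) < e"
proof -
  interpret finite_measure m by fact
  have meas: "U \<in> sets m" if "openin (top_of_set \<Omega>) U" for U
    using openin_sets_borel_on[OF that] by (simp add: m(2))
  have measK: "K \<in> sets m" if "compact K" "K \<subseteq> A" "A \<subseteq> U" "openin (top_of_set \<Omega>) U" for K U A
    using that openin_imp_subset[OF that(4)] by (auto simp: m(2) intro!: compact_sets_borel_on)
  \<comment> \<open>The gap is quantified inside the induction because a countable union uses the
    hypothesis at ever smaller gaps.\<close>
  have "\<forall>e>0. \<exists>K U. compact K \<and> openin (top_of_set \<Omega>) U \<and> K \<subseteq> A \<and> A \<subseteq> U \<and> measure m (U - K) < e"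
    using A unfolding sets_borel_on_eq
  proof (induction rule: sigma_sets.induct)
    case (Basic U)
    then have U: "openin (top_of_set \<Omega>) U" by simp
    obtain K :: "nat \<Rightarrow> 'o set" where K: "\<And>n. compact (K n)" "\<And>n. K n \<subseteq> U"
      and lim: "(\<lambda>n. measure m (K n)) \<longlonglongrightarrow> measure m U"
      using open_compact_approx[OF \<Omega> m U] by blast
    show ?case
    proof (intro allI impI)
      fix e :: real assume "0 < e"
      then have "\<forall>\<^sub>F n in sequentially. \<bar>measure m (K n) - measure m U\<bar> < e"
        using lim by (simp add: tendsto_iff dist_real_def)
      then obtain n where n: "\<bar>measure m (K n) - measure m U\<bar> < e" by (auto simp: eventually_sequentially)
      have "measure m (U - K n) = measure m U - measure m (K n)"
        using K U by (intro finite_measure_Diff meas measK[OF _ _ order_refl]) auto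
      then show "\<exists>K V. compact K \<and> openin (top_of_set \<Omega>) V \<and> K \<subseteq> U \<and> U \<subseteq> V \<and> measure m (V - K) < e"
        using K[of n] U n by (intro exI[of _ "K n"] exI[of _ U]) auto
    qed
  next
    case Empty
    show ?case
    proof (intro allI impI)
      fix e :: real assume "0 < e"
      then have "compact ({} :: 'o set) \<and> openin (top_of_set \<Omega>) {} \<and> {} \<subseteq> ({} :: 'o set) \<and>
          {} \<subseteq> ({} :: 'o set) \<and> measure m ({} - {}) < e" by simp
      then show "\<exists>K U. compact K \<and> openin (top_of_set \<Omega>) U \<and> K \<subseteq> {} \<and> {} \<subseteq> U \<and> measure m (U - K) < e"
        by blast
    qed
  next
    case (Compl A)
    show ?case
    proof (intro allI impI)
      fix e :: real assume "0 < e"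
      from Compl.IH[rule_format, OF this]
      obtain K U where KU: "compact K" "openin (top_of_set \<Omega>) U" "K \<subseteq> A" "A \<subseteq> U" "measure m (U - K) < e"
        by (elim exE conjE)
      have "compact (\<Omega> - U)"
        by (rule closedin_compact[OF \<Omega>]) (simp add: closedin_diff KU(2))
      moreover have "openin (top_of_set \<Omega>) (\<Omega> - K)"
        using compact_imp_closed[OF KU(1)] by (auto simp: openin_open intro: exI[of _ "- K"])
      moreover have "\<Omega> - K - (\<Omega> - U) = U - K" using openin_imp_subset[OF KU(2)] by auto
      ultimately show "\<exists>K U. compact K \<and> openin (top_of_set \<Omega>) U \<and> K \<subseteq> \<Omega> - A \<and> \<Omega> - A \<subseteq> U \<and> measure m (U - K) < e"
        using KU by (intro exI[of _ "\<Omega> - U"] exI[of _ "\<Omega> - K"] conjI Diff_mono order_refl) simp_all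
    qed
  next
    case (Union A)
    show ?case
    proof (intro allI impI)
      fix e :: real assume e: "0 < e"
      \<comment> \<open>Half of \<open>e\<close> pays for all the gaps \<open>U i - K i\<close>
        together; the other half is left for discarding all but finitely many
        \<open>K i\<close>.\<close>
      then have pos: "0 < e / 2 * (1/2) ^ Suc i" for i by simp
      have "\<forall>i. \<exists>K U. compact K \<and> openin (top_of_set \<Omega>) U \<and> K \<subseteq> A i \<and> A i \<subseteq> U \<and>
          measure m (U - K) < e / 2 * (1/2) ^ Suc i"
        using Union.IH pos by (intro allI) (rule Union.IH[rule_format])
      then obtain K U where K: "\<And>i. compact (K i)" and U: "\<And>i. openin (top_of_set \<Omega>) (U i)"
        and KA: "\<And>i. K i \<subseteq> A i" and AU: "\<And>i. A i \<subseteq> U i"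
        and less: "\<And>i. measure m (U i - K i) < e / 2 * (1/2) ^ Suc i"
        by metis
      have [measurable]: "U i \<in> sets m" "K i \<in> sets m" for i
        using meas[OF U] measK[OF K KA AU U] by auto
      have sum: "summable (\<lambda>i. e / 2 * (1/2::real) ^ Suc i)" "(\<Sum>i. e / 2 * (1/2) ^ Suc i) = e / 2"
        using sums_mult[OF power_half_series, of "e/2"] by (simp_all add: sums_iff)
      have sum': "summable (\<lambda>i. measure m (U i - K i))"
        by (rule summable_comparison_test'[OF sum(1), of 0]) (use less in \<open>auto intro: less_imp_le\<close>)
      have "measure m ((\<Union>i. U i) - (\<Union>i. K i)) \<le> measure m (\<Union>i. U i - K i)"
        by (intro finite_measure_mono) auto
      also have "\<dots> \<le> (\<Sum>i. measure m (U i - K i))"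
        by (intro finite_measure_subadditive_countably sum') auto
      also have "\<dots> \<le> (\<Sum>i. e / 2 * (1/2) ^ Suc i)"
        by (intro suminf_le sum' sum(1) less_imp_le[OF less])
      also have "\<dots> = e / 2" by (rule sum(2))
      finally have le: "measure m ((\<Union>i. U i) - (\<Union>i. K i)) \<le> e / 2" .
      \<comment> \<open>The union of all \<open>K i\<close> need not be compact; continuity from
        above permits stopping at a finite union.\<close>
      have "(\<lambda>n. measure m ((\<Union>i. U i) - (\<Union>i<n. K i))) \<longlonglongrightarrow> measure m (\<Inter>n. (\<Union>i. U i) - (\<Union>i<n. K i))"
      proof (rule finite_Lim_measure_decseq)
        show "decseq (\<lambda>n. (\<Union>i. U i) - (\<Union>i<n. K i))"
          unfolding decseq_def by (intro allI impI Diff_mono order_refl UN_mono) auto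
      qed auto
      also have "(\<Inter>n. (\<Union>i. U i) - (\<Union>i<n. K i)) = (\<Union>i. U i) - (\<Union>i. K i)" by auto
      finally have "\<forall>\<^sub>F n in sequentially. measure m ((\<Union>i. U i) - (\<Union>i<n. K i)) < e"
        by (rule order_tendstoD) (use le e in simp)
      then obtain n where n: "measure m ((\<Union>i. U i) - (\<Union>i<n. K i)) < e" by (auto simp: eventually_sequentially)
      have "compact (\<Union>i<n. K i)" using K by (intro compact_UN) auto
      moreover have "openin (top_of_set \<Omega>) (\<Union>i. U i)" using U by auto
      moreover have "(\<Union>i<n. K i) \<subseteq> (\<Union>i. A i)" "(\<Union>i. A i) \<subseteq> (\<Union>i. U i)" using KA AU by blast+
      ultimately show "\<exists>K U. compact K \<and> openin (top_of_set \<Omega>) U \<and> K \<subseteq> (\<Union>i. A i) \<and> (\<Union>i. A i) \<subseteq> U \<and> measure m (U - K) < e"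
        using n by blast
    qed
  qed
  then show ?thesis using e by blast
qed

text \<open>Regularity is transferred from the finite measure representing the variation: compact
  exhaustion of open sets gives the inner condition, and the sandwich
  \<open>K \<subseteq> B \<subseteq> U\<close> with small gap gives the outer one.\<close>

lemma finite_signed_measure_Radon:
  fixes \<Omega> :: "'o::metric_space set"
  assumes \<Omega>: "compact \<Omega>" and \<nu>: "finite_signed_measure \<Omega> \<nu>"
  shows "\<nu> \<in> Radon_measures \<Omega>"
proof -
  let ?N = "borel_on \<Omega>" and ?v = "signed_variation_ennreal \<Omega> \<nu>"
  obtain m where m: "finite_measure m" "sets m = sets ?N"
    and v: "\<And>A. A \<in> sets ?N \<Longrightarrow> ?v A = emeasure m A"
    using ex_variation_measure[OF \<nu>] by blast
  interpret finite_measure m by fact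
  have "?v U = (SUP K\<in>{K. compact K \<and> K \<subseteq> U}. ?v K)" if U: "openin (top_of_set \<Omega>) U" for U
  proof (rule antisym)
    have U': "U \<in> sets ?N" "U \<subseteq> \<Omega>" using openin_sets_borel_on[OF U] openin_imp_subset[OF U] by auto
    have K': "K \<in> sets ?N" if "compact K" "K \<subseteq> U" for K
      using that U'(2) by (intro compact_sets_borel_on) auto
    show "(SUP K\<in>{K. compact K \<and> K \<subseteq> U}. ?v K) \<le> ?v U"
      using U' K' by (auto simp: v m(2) intro!: SUP_least emeasure_mono)
    obtain K :: "nat \<Rightarrow> 'o set" where K: "\<And>n. compact (K n)" "\<And>n. K n \<subseteq> U"
      and lim: "(\<lambda>n. measure m (K n)) \<longlonglongrightarrow> measure m U"
      using open_compact_approx[OF \<Omega> m U] by blast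
    have "(\<lambda>n. emeasure m (K n)) \<longlonglongrightarrow> emeasure m U"
      using lim by (simp add: emeasure_eq_measure tendsto_ennrealI)
    then have "emeasure m U \<le> (SUP K\<in>{K. compact K \<and> K \<subseteq> U}. ?v K)"
    proof (rule LIMSEQ_le_const2, intro exI[of _ 0] allI impI)
      fix n
      have "emeasure m (K n) = ?v (K n)" using K' K by (simp add: v)
      also have "\<dots> \<le> (SUP K\<in>{K. compact K \<and> K \<subseteq> U}. ?v K)" using K by (intro SUP_upper) auto
      finally show "emeasure m (K n) \<le> (SUP K\<in>{K. compact K \<and> K \<subseteq> U}. ?v K)" .
    qed
    then show "?v U \<le> (SUP K\<in>{K. compact K \<and> K \<subseteq> U}. ?v K)" using U' by (simp add: v)
  qed
  moreover have "?v B = (INF U\<in>{U. openin (top_of_set \<Omega>) U \<and> B \<subseteq> U}. ?v U)"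
    if B: "B \<in> sets ?N" for B
  proof (rule antisym)
    show "?v B \<le> (INF U\<in>{U. openin (top_of_set \<Omega>) U \<and> B \<subseteq> U}. ?v U)"
    proof (rule INF_greatest)
      fix U assume "U \<in> {U. openin (top_of_set \<Omega>) U \<and> B \<subseteq> U}"
      then show "?v B \<le> ?v U"
        using B openin_sets_borel_on[of \<Omega> U] by (auto simp: v m(2) intro!: emeasure_mono)
    qed
    show "(INF U\<in>{U. openin (top_of_set \<Omega>) U \<and> B \<subseteq> U}. ?v U) \<le> ?v B"
    proof (rule ennreal_le_epsilon)
      fix e :: real assume e: "0 < e"
      obtain K U where KU: "openin (top_of_set \<Omega>) U" "compact K" "K \<subseteq> B" "B \<subseteq> U" "measure m (U - K) < e"
        using compact_open_regular[OF \<Omega> m B e] by blast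
      have sets: "U \<in> sets m" "B \<in> sets m" "K \<in> sets m"
        using KU B openin_imp_subset[OF KU(1)]
        by (auto simp: m(2) openin_sets_borel_on intro!: compact_sets_borel_on)
      have "(INF U\<in>{U. openin (top_of_set \<Omega>) U \<and> B \<subseteq> U}. ?v U) \<le> ?v U"
        using KU by (intro INF_lower) auto
      also have "\<dots> = ennreal (measure m U)" using sets by (simp add: v m(2) emeasure_eq_measure)
      also have "measure m U \<le> measure m B + measure m (U - K)"
      proof -
        have "measure m U = measure m (K \<union> (U - K))" using KU by (intro arg_cong[where f="measure m"]) auto
        also have "\<dots> \<le> measure m K + measure m (U - K)" using sets by (intro measure_Un_le) auto
        also have "measure m K \<le> measure m B" using sets KU by (intro finite_measure_mono) auto
        finally show ?thesis by simp
      qed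
      then have "ennreal (measure m U) \<le> ennreal (measure m B + e)" using KU by (intro ennreal_leI) simp
      also have "\<dots> = ?v B + ennreal e" using sets e by (simp add: v m(2) emeasure_eq_measure)
      finally show "(INF U\<in>{U. openin (top_of_set \<Omega>) U \<and> B \<subseteq> U}. ?v U) \<le> ?v B + ennreal e" .
    qed
  qed
  ultimately show ?thesis using \<nu> by (simp add: Radon_measures_def)
qed

section \<open>Cantor space\<close>

text \<open>These are the clopen subsets of Cantor space. The implication in one direction suffices,
  since \<open>y\<close> and \<open>z\<close> may be exchanged; closure under complements rests on
  this.\<close>

definition cylinders :: "(nat \<Rightarrow> bool) set set" where
  "cylinders = {A. \<exists>n. \<forall>y z. (\<forall>i<n. y i = z i) \<longrightarrow> y \<in> A \<longrightarrow> z \<in> A}"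

definition cantor :: "(nat \<Rightarrow> bool) measure" where
  "cantor = sigma UNIV cylinders"

lemma space_cantor [simp]: "space cantor = UNIV"
  and sets_cantor: "sets cantor = sigma_sets UNIV cylinders"
  by (simp_all add: cantor_def)

lemma cylinders_subset_sets_cantor: "A \<in> cylinders \<Longrightarrow> A \<in> sets cantor"
  by (simp add: sets_cantor)

lemma algebra_cylinders: "algebra UNIV cylinders"
  unfolding algebra_iff_Un
proof (intro conjI ballI)
  fix A B assume "A \<in> cylinders" "B \<in> cylinders"
  then obtain m n where m: "\<And>y z. (\<forall>i<m. y i = z i) \<Longrightarrow> y \<in> A \<Longrightarrow> z \<in> A"
    and n: "\<And>y z. (\<forall>i<n. y i = z i) \<Longrightarrow> y \<in> B \<Longrightarrow> z \<in> B"
    unfolding cylinders_def by blast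
  show "A \<union> B \<in> cylinders"
    unfolding cylinders_def mem_Collect_eq
  proof (intro exI[of _ "max m n"] allI impI)
    fix y z assume yz: "\<forall>i<max m n. y i = z i" and "y \<in> A \<union> B"
    then show "z \<in> A \<union> B" using m[of y z] n[of y z] by auto
  qed
next
  fix A assume "A \<in> cylinders"
  then obtain m where m: "\<And>y z. (\<forall>i<m. y i = z i) \<Longrightarrow> y \<in> A \<Longrightarrow> z \<in> A"
    unfolding cylinders_def by blast
  show "UNIV - A \<in> cylinders"
    unfolding cylinders_def mem_Collect_eq
  proof (intro exI[of _ m] allI impI)
    fix y z assume yz: "\<forall>i<m. y i = z i" and "y \<in> UNIV - A"
    then show "z \<in> UNIV - A" using m[of z y] by auto
  qed
qed (auto simp: cylinders_def)

interpretation cylinders: algebra UNIV cylinders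
  by (rule algebra_cylinders)

text \<open>A cylinder is determined by a length \<open>n\<close> and the finite set of admissible
  prefixes of that length. Countability is what allows one null set of \<open>x\<close> to serve all
  cylinders.\<close>

lemma countable_cylinders: "countable cylinders"
proof (rule countable_subset)
  show "cylinders \<subseteq> (\<lambda>(n, S). {y. map y [0..<n] \<in> S}) ` (UNIV \<times> Collect finite)"
  proof
    fix A assume "A \<in> cylinders"
    then obtain n where n: "\<And>y z. (\<forall>i<n. y i = z i) \<Longrightarrow> y \<in> A \<Longrightarrow> z \<in> A"
      unfolding cylinders_def by blast
    define S where "S = (\<lambda>y. map y [0..<n]) ` A"
    have "S \<subseteq> {l. set l \<subseteq> UNIV \<and> length l = n}" by (auto simp: S_def)
    then have "finite S" by (rule finite_subset) (rule finite_lists_length_eq, simp)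
    moreover have "A = {y. map y [0..<n] \<in> S}"
    proof (intro equalityI subsetI)
      fix y assume "y \<in> {y. map y [0..<n] \<in> S}"
      then obtain z where "z \<in> A" "map y [0..<n] = map z [0..<n]" by (auto simp: S_def)
      then show "y \<in> A" using n[of z y] by auto
    qed (auto simp: S_def)
    ultimately show "A \<in> (\<lambda>(n, S). {y. map y [0..<n] \<in> S}) ` (UNIV \<times> Collect finite)"
      by (intro image_eqI[of _ _ "(n, S)"]) auto
  qed
  show "countable ((\<lambda>(n, S). {y :: nat \<Rightarrow> bool. map y [0..<n] \<in> S}) ` (UNIV \<times> Collect finite))"
    by (intro countable_image countable_SIGMA countable_Collect_finite) auto
qed

lemma coordinate_cylinder: "{y. y i} \<in> cylinders"
  by (auto simp: cylinders_def intro!: exI[of _ "Suc i"])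

lemma open_cylinder: "A \<in> cylinders \<Longrightarrow> open A"
proof -
  assume "A \<in> cylinders"
  then obtain n where n: "\<And>y z. (\<forall>i<n. y i = z i) \<Longrightarrow> y \<in> A \<Longrightarrow> z \<in> A"
    unfolding cylinders_def by blast
  have "A = (\<Union>y\<in>A. {z. \<forall>i\<in>{..<n}. z i \<in> {y i}})"
  proof (intro equalityI subsetI)
    fix z assume "z \<in> (\<Union>y\<in>A. {z. \<forall>i\<in>{..<n}. z i \<in> {y i}})"
    then obtain y where "y \<in> A" "\<forall>i<n. y i = z i" by auto
    then show "z \<in> A" using n[of y z] by simp
  qed auto
  moreover have "open (\<Union>y\<in>A. {z. \<forall>i\<in>{..<n}. z i \<in> {y i}})"
    by (intro open_UN ballI product_topology_basis'[where x="\<lambda>i. i"]) (auto intro: Topological_Spaces.open_discrete)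
  ultimately show "open A" by simp
qed

lemma closed_cylinder: "A \<in> cylinders \<Longrightarrow> closed A"
  unfolding closed_def Compl_eq_Diff_UNIV by (intro open_cylinder cylinders.compl_sets)

lemma compact_UNIV_cantor: "compact (UNIV :: (nat \<Rightarrow> bool) set)"
proof -
  have "compactin (product_topology (\<lambda>i::nat. euclidean :: bool topology) UNIV) (PiE UNIV (\<lambda>_. UNIV))"
    unfolding compactin_PiE by (simp add: finite_imp_compact)
  then show ?thesis by (simp add: euclidean_product_topology)
qed

text \<open>Cylinders are closed in a compact space, so a decreasing sequence of them with empty
  intersection is eventually empty. Continuity at the empty set, the condition in Caratheodory's
  theorem that goes beyond additivity, therefore holds trivially.\<close>

lemma cylinder_content_extension:
  fixes f :: "(nat \<Rightarrow> bool) set \<Rightarrow> real"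
  assumes add: "\<And>A B. A \<in> cylinders \<Longrightarrow> B \<in> cylinders \<Longrightarrow> A \<inter> B = {} \<Longrightarrow> f (A \<union> B) = f A + f B"
    and nonneg: "\<And>A. A \<in> cylinders \<Longrightarrow> 0 \<le> f A"
  shows "\<exists>m. finite_measure m \<and> sets m = sets cantor \<and> (\<forall>A\<in>cylinders. measure m A = f A)"
proof -
  have "\<exists>\<mu>. (\<forall>s\<in>cylinders. \<mu> s = ennreal (f s)) \<and> measure_space UNIV (sigma_sets UNIV cylinders) \<mu>"
  proof (rule cylinders.caratheodory_empty_continuous)
    have "f {} = 0" using add[of "{}" "{}"] by simp
    then show "positive cylinders (\<lambda>s. ennreal (f s))" by (simp add: positive_def)
    show "additive cylinders (\<lambda>s. ennreal (f s))"
      using add nonneg by (simp add: additive_def)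
    fix A :: "nat \<Rightarrow> (nat \<Rightarrow> bool) set"
    assume A: "range A \<subseteq> cylinders" "decseq A" "(\<Inter>i. A i) = {}"
    have "\<exists>n. A n = {}"
    proof (rule ccontr)
      assume ne: "\<nexists>n. A n = {}"
      have "UNIV \<inter> (\<Inter>i\<in>UNIV. A i) \<noteq> {}"
      proof (rule compact_imp_fip_image[OF compact_UNIV_cantor])
        show "closed (A i)" for i using A(1) by (intro closed_cylinder) auto
        fix I :: "nat set" assume "finite I"
        then obtain k where "\<And>i. i \<in> I \<Longrightarrow> i \<le> k" by (meson finite_nat_set_iff_bounded_le)
        then have "A k \<subseteq> UNIV \<inter> (\<Inter>i\<in>I. A i)" using decseqD[OF A(2)] by blast
        then show "UNIV \<inter> (\<Inter>i\<in>I. A i) \<noteq> {}" using ne by blast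
      qed
      then show False using A(3) by simp
    qed
    then obtain n where n: "A n = {}" by blast
    have "A k = {}" if "n \<le> k" for k using decseqD[OF A(2) that] n by auto
    then have "\<forall>\<^sub>F k in sequentially. ennreal (f (A k)) = 0"
      using \<open>f {} = 0\<close> by (auto simp: eventually_sequentially intro!: exI[of _ n])
    then show "(\<lambda>i. ennreal (f (A i))) \<longlonglongrightarrow> 0" by (rule tendsto_eventually)
  qed simp
  then obtain \<mu> where \<mu>: "\<And>s. s \<in> cylinders \<Longrightarrow> \<mu> s = ennreal (f s)"
    and ms: "measure_space UNIV (sets cantor) \<mu>"
    unfolding sets_cantor by blast
  let ?m = "measure_of UNIV (sets cantor) \<mu>"
  have sets: "sets ?m = sets cantor"
    using sets.sets_measure_of_eq[of cantor] by simp
  have em: "emeasure ?m A = \<mu> A" if "A \<in> sets cantor" for A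
    using ms that by (intro emeasure_measure_of_sigma) (auto simp: measure_space_def)
  have "measure ?m A = f A" if "A \<in> cylinders" for A
    using em[OF cylinders_subset_sets_cantor[OF that]] \<mu>[OF that] nonneg[OF that] by (simp add: measure_def)
  moreover have "finite_measure ?m"
    using em[OF sets.top[of cantor]] \<mu>[OF cylinders.top] by (intro finite_measureI) simp
  ultimately show ?thesis using sets by blast
qed

text \<open>The upper variation and its difference with \<open>f\<close> are nonnegative and
  finitely additive, and each is extended separately; countable additivity arises only in the
  extension.\<close>

lemma cylinder_content_Jordan:
  assumes "bounded_content UNIV cylinders f c"
  shows "\<exists>m1 m2. finite_measure m1 \<and> finite_measure m2 \<and> sets m1 = sets cantor \<and> sets m2 = sets cantor \<and>
    (\<forall>A\<in>cylinders. f A = measure m1 A - measure m2 A)"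
proof -
  interpret bounded_content UNIV cylinders f c by fact
  obtain m1 where m1: "finite_measure m1" "sets m1 = sets cantor"
    "\<And>A. A \<in> cylinders \<Longrightarrow> measure m1 A = upper_variation A"
    using cylinder_content_extension[of upper_variation] upper_variation_add upper_variation_nonneg by blast
  have "\<exists>m2. finite_measure m2 \<and> sets m2 = sets cantor \<and> (\<forall>A\<in>cylinders. measure m2 A = upper_variation A - f A)"
    by (rule cylinder_content_extension) (auto simp: upper_variation_add add le_upper_variation)
  then obtain m2 where m2: "finite_measure m2" "sets m2 = sets cantor"
    "\<And>A. A \<in> cylinders \<Longrightarrow> measure m2 A = upper_variation A - f A" by blast
  show ?thesis
    by (intro exI[of _ m1] exI[of _ m2] conjI ballI m1(1,2) m2(1,2)) (simp add: m1(3) m2(3))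
qed

text \<open>Membership in a cylinder is a finite Boolean condition on the first coordinates.\<close>

lemma measurable_into_cantor:
  assumes [measurable]: "\<And>i. (\<lambda>x. F x i) \<in> measurable N (count_space UNIV)"
  shows "F \<in> measurable N cantor"
  unfolding cantor_def
proof (rule measurable_measure_of)
  fix A assume "A \<in> cylinders"
  then obtain n where n: "\<And>y z. (\<forall>i<n. y i = z i) \<Longrightarrow> y \<in> A \<Longrightarrow> z \<in> A"
    unfolding cylinders_def by blast
  define S where "S = (\<lambda>y. map y [0..<n]) ` A"
  have "S \<subseteq> {l. set l \<subseteq> UNIV \<and> length l = n}" by (auto simp: S_def)
  then have fin: "finite S" by (rule finite_subset) (rule finite_lists_length_eq, simp)
  have "F x \<in> A \<longleftrightarrow> (\<exists>l\<in>S. \<forall>i<n. F x i = l ! i)" for x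
  proof
    assume "\<exists>l\<in>S. \<forall>i<n. F x i = l ! i"
    then obtain y where "y \<in> A" "\<forall>i<n. F x i = y i" by (auto simp: S_def)
    then show "F x \<in> A" using n[of y "F x"] by auto
  qed (auto simp: S_def)
  then have "F -` A \<inter> space N = {x\<in>space N. \<exists>l\<in>S. \<forall>i<n. F x i = l ! i}" by auto
  also have "\<dots> \<in> sets N"
    using fin by measurable
  finally show "F -` A \<inter> space N \<in> sets N" .
qed auto

section \<open>Borel coding of a compact metric space in Cantor space\<close>

lemma compact_dense_sequence:
  fixes \<Omega> :: "'o::metric_space set"
  assumes \<Omega>: "compact \<Omega>" "\<Omega> \<noteq> {}"
  shows "\<exists>d::nat \<Rightarrow> 'o. range d \<subseteq> \<Omega> \<and> (\<forall>x\<in>\<Omega>. \<forall>e>0. \<exists>i. dist (d i) x < e)"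
proof -
  have "\<forall>n::nat. \<exists>k. finite k \<and> k \<subseteq> \<Omega> \<and> \<Omega> \<subseteq> (\<Union>x\<in>k. ball x (inverse (Suc n)))"
    using seq_compact_imp_totally_bounded[OF compact_imp_seq_compact[OF \<Omega>(1)]] by simp
  then obtain k where k: "\<And>n::nat. finite (k n)" "\<And>n. k n \<subseteq> \<Omega>"
    "\<And>n. \<Omega> \<subseteq> (\<Union>x\<in>k n. ball x (inverse (Suc n)))" by metis
  define D where "D = (\<Union>n. k n)"
  have "countable D" unfolding D_def by (intro countable_UN countableI_type countable_finite[OF k(1)])
  moreover have "D \<noteq> {}" using k(3)[of 0] \<Omega>(2) by (auto simp: D_def)
  ultimately have range: "range (from_nat_into D) = D" by (simp add: range_from_nat_into)
  show ?thesis
  proof (intro exI[of _ "from_nat_into D"] conjI ballI allI impI)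
    show "range (from_nat_into D) \<subseteq> \<Omega>" using range k(2) by (auto simp: D_def)
    fix x e assume "x \<in> \<Omega>" "0 < (e::real)"
    then obtain n where n: "inverse (Suc n) < e" using reals_Archimedean by blast
    obtain y where y: "y \<in> k n" "x \<in> ball y (inverse (Suc n))" using k(3)[of n] \<open>x \<in> \<Omega>\<close> by blast
    then have "y \<in> range (from_nat_into D)" unfolding range by (auto simp: D_def)
    then obtain i where "y = from_nat_into D i" by auto
    then show "\<exists>i. dist (from_nat_into D i) x < e" using y n by (intro exI[of _ i]) (simp add: del: of_nat_Suc)
  qed
qed

text \<open>
  The code of \<open>x\<close> records, for a dense sequence \<open>d\<close>, which of the points \<open>d i\<close> lie within \<open>2\<^sup>-\<^sup>k\<close> of
  \<open>x\<close>. Decoding reads off from \<open>y\<close> the first such index for every \<open>k\<close> and passes to the limit.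
\<close>

lemma ex_cantor_coding:
  fixes \<Omega> :: "'o::metric_space set"
  assumes \<Omega>: "compact \<Omega>" "\<Omega> \<noteq> {}"
  shows "\<exists>\<Phi> \<Psi>. \<Phi> \<in> measurable (borel_on \<Omega>) cantor \<and> \<Psi> \<in> measurable cantor (borel_on \<Omega>) \<and>
    (\<forall>x\<in>\<Omega>. \<Psi> (\<Phi> x) = x)"
proof -
  obtain d :: "nat \<Rightarrow> 'o" where d: "\<And>i. d i \<in> \<Omega>" and dense: "\<And>x e. x \<in> \<Omega> \<Longrightarrow> 0 < e \<Longrightarrow> \<exists>i. dist (d i) x < e"
    using compact_dense_sequence[OF \<Omega>] by blast
  define \<Phi> where "\<Phi> x n = (case prod_decode n of (i, k) \<Rightarrow> dist (d i) x < (1/2) ^ k)" for x n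
  have \<Phi>: "\<Phi> \<in> measurable (borel_on \<Omega>) cantor"
  proof (rule measurable_into_cantor)
    fix n
    obtain i k where ik: "prod_decode n = (i, k)" by fastforce
    have "{x. dist (d i) x < (1/2) ^ k} \<in> sets borel" by (intro borel_open open_Collect_less continuous_intros)
    then have "(\<lambda>x. \<Phi> x n) \<in> measurable borel (count_space UNIV)" by (simp add: \<Phi>_def ik pred_def)
    then show "(\<lambda>x. \<Phi> x n) \<in> measurable (borel_on \<Omega>) (count_space UNIV)"
      by (rule measurable_restrict_space1)
  qed
  define I where "I k y = (LEAST i. y (prod_encode (i, k)))" for k and y :: "nat \<Rightarrow> bool"
  have coord: "(\<lambda>y. y j) \<in> measurable cantor (count_space UNIV)" for j
    using cylinders_subset_sets_cantor[OF coordinate_cylinder[of j]] by (simp add: pred_def)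
  have I [measurable]: "I k \<in> measurable cantor (count_space UNIV)" for k
    unfolding I_def by (intro measurable_Least coord)
  \<comment> \<open>\<open>I m\<close> and \<open>I n\<close> take countably many values, so it is
    enough to treat fixed indices.\<close>
  have [measurable]: "(\<lambda>y. dist (d (I m y)) (d (I n y))) \<in> borel_measurable cantor" for m n
    by (rule measurable_compose_countable[OF _ I], rule measurable_compose_countable[OF _ I]) simp
  define Y where "Y = {y. Cauchy (\<lambda>k. d (I k y))}"
  have Y: "Y \<in> sets cantor"
  proof -
    have "{y\<in>space cantor. \<forall>j. \<exists>M. \<forall>m\<ge>M. \<forall>n\<ge>M. dist (d (I m y)) (d (I n y)) < inverse (real (Suc j))} \<in> sets cantor"
      by measurable
    then show ?thesis by (simp add: Y_def metric_Cauchy_iff2)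
  qed
  \<comment> \<open>Off \<open>Y\<close> the index is frozen at 0, so the sequence converges for
    every \<open>y\<close> and the limit \<open>\<Psi> y\<close> always lies in
    \<open>\<Omega>\<close>.\<close>
  define g where "g k y = d (if y \<in> Y then I k y else 0)" for k y
  have g: "g k \<in> borel_measurable cantor" for k
  proof -
    have "(\<lambda>y. if y \<in> Y then I k y else 0) \<in> measurable cantor (count_space UNIV)"
      using Y by measurable
    then have "(\<lambda>y. d (if y \<in> Y then I k y else 0)) \<in> borel_measurable cantor"
      by (rule measurable_compose) simp
    then show ?thesis by (simp add: g_def[abs_def])
  qed
  have "\<exists>l\<in>\<Omega>. (\<lambda>k. g k y) \<longlonglongrightarrow> l" for y
  proof (cases "y \<in> Y")
    case True
    then have "Cauchy (\<lambda>k. g k y)" by (simp add: Y_def g_def)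
    moreover have "\<forall>k. g k y \<in> \<Omega>" using d by (simp add: g_def)
    ultimately show ?thesis
      using compact_imp_complete[OF \<Omega>(1), unfolded complete_def, rule_format, of "\<lambda>k. g k y"] by simp
  next
    case False
    then show ?thesis using d by (intro bexI[of _ "d 0"]) (simp_all add: g_def)
  qed
  then obtain \<Psi> where \<Psi>: "\<And>y. \<Psi> y \<in> \<Omega>" "\<And>y. (\<lambda>k. g k y) \<longlonglongrightarrow> \<Psi> y" by metis
  have "\<Psi> \<in> borel_measurable cantor"
    by (rule borel_measurable_LIMSEQ_metric[OF g \<Psi>(2)])
  then have "\<Psi> \<in> measurable cantor (borel_on \<Omega>)"
    using \<Psi>(1) by (intro measurable_restrict_space2) auto
  moreover have "\<Psi> (\<Phi> x) = x" if x: "x \<in> \<Omega>" for x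
  proof -
    have less: "dist (d (I k (\<Phi> x))) x < (1/2) ^ k" for k
    proof -
      \<comment> \<open>Density provides a true coordinate for each \<open>k\<close>, so the
        \<open>LEAST\<close> in \<open>I\<close> really finds a point within
        \<open>(1/2) ^ k\<close> of \<open>x\<close>.\<close>
      have "\<exists>i. \<Phi> x (prod_encode (i, k))" using dense[OF x, of "(1/2)^k"] by (simp add: \<Phi>_def)
      then have "\<Phi> x (prod_encode (I k (\<Phi> x), k))" unfolding I_def by (rule LeastI_ex)
      then show ?thesis by (simp add: \<Phi>_def)
    qed
    have lim: "(\<lambda>k. d (I k (\<Phi> x))) \<longlonglongrightarrow> x"
    proof (rule metric_tendsto_imp_tendsto)
      show "(\<lambda>k. (1/2) ^ k :: real) \<longlonglongrightarrow> 0" by (intro LIMSEQ_power_zero) simp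
      show "\<forall>\<^sub>F k in sequentially. dist (d (I k (\<Phi> x))) x \<le> dist ((1/2) ^ k :: real) 0"
        using less by (auto intro!: always_eventually less_imp_le)
    qed
    then have "\<Phi> x \<in> Y" unfolding Y_def by (auto intro: LIMSEQ_imp_Cauchy)
    then have "(\<lambda>k. g k (\<Phi> x)) \<longlonglongrightarrow> x" using lim by (simp add: g_def)
    then show ?thesis using \<Psi>(2) LIMSEQ_unique by blast
  qed
  ultimately show ?thesis using \<Phi> by blast
qed

section \<open>Classes of measurable functions and \<open>L\<^sup>0\<close>-valued measures\<close>

lemma ae_class_cong: "AE x in M. f x = g x \<Longrightarrow> ae_class M f = ae_class M g"
  unfolding ae_class_def by (auto elim: AE_mp)

lemma ae_class_in_L0: "f \<in> borel_measurable M \<Longrightarrow> ae_class M f \<in> L0 M"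
  by (simp add: L0_def)

lemma L0_rep_in: "F \<in> L0 M \<Longrightarrow> L0_rep F \<in> F"
proof -
  assume "F \<in> L0 M"
  then obtain f where "f \<in> F" by (auto simp: L0_def ae_class_def)
  then show ?thesis unfolding L0_rep_def by (metis someI)
qed

lemma L0_rep_measurable [measurable (raw)]: "F \<in> L0 M \<Longrightarrow> L0_rep F \<in> borel_measurable M"
  using L0_rep_in[of F M] by (auto simp: L0_def ae_class_def)

lemma AE_L0_rep: "f \<in> borel_measurable M \<Longrightarrow> AE x in M. L0_rep (ae_class M f) x = f x"
  using L0_rep_in[OF ae_class_in_L0[of f M]] by (auto simp: ae_class_def)

lemma ae_class_L0_rep: "F \<in> L0 M \<Longrightarrow> ae_class M (L0_rep F) = F"
proof -
  assume "F \<in> L0 M"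
  then obtain f where "f \<in> borel_measurable M" "F = ae_class M f" by (auto simp: L0_def)
  then show ?thesis using ae_class_cong[OF AE_L0_rep[of f M]] by simp
qed

lemma L0_le_antisym:
  fixes F G :: "('x \<Rightarrow> 'b::{topological_space, order}) set"
  assumes "F \<in> L0 M" "G \<in> L0 M" "L0_le M F G" "L0_le M G F"
  shows "F = G"
proof -
  have "AE x in M. L0_rep F x = L0_rep G x"
    using assms(3,4) unfolding L0_le_def by eventually_elim (rule antisym)
  then have "ae_class M (L0_rep F) = ae_class M (L0_rep G)" by (rule ae_class_cong)
  then show ?thesis using assms by (simp add: ae_class_L0_rep)
qed

lemma L0_le_ae_class_iff:
  assumes "f \<in> borel_measurable M" "g \<in> borel_measurable M"
  shows "L0_le M (ae_class M f) (ae_class M g) \<longleftrightarrow> (AE x in M. f x \<le> g x)"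
  unfolding L0_le_def using AE_L0_rep[OF assms(1)] AE_L0_rep[OF assms(2)]
  by (intro eventually_cong[where F="ae_filter M"]) (auto elim: eventually_elim2)

lemma L0_to_bar_in_L0: "F \<in> L0 M \<Longrightarrow> L0_to_bar M F \<in> L0 M"
  unfolding L0_to_bar_def by (intro ae_class_in_L0) measurable

lemma L0_to_bar_le_iff:
  assumes "F \<in> L0 M" "G \<in> L0 M"
  shows "L0_le M (L0_to_bar M F) (L0_to_bar M G) \<longleftrightarrow> (AE x in M. L0_rep F x \<le> L0_rep G x)"
  unfolding L0_to_bar_def using assms by (subst L0_le_ae_class_iff) auto

lemma L0_abs_in_L0: "F \<in> L0 M \<Longrightarrow> L0_abs M F \<in> L0 M"
  unfolding L0_abs_def by (intro ae_class_in_L0) measurable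

lemma AE_L0_rep_abs: "F \<in> L0 M \<Longrightarrow> AE x in M. L0_rep (L0_abs M F) x = \<bar>L0_rep F x\<bar>"
  unfolding L0_abs_def by (intro AE_L0_rep) measurable

text \<open>The integrand of the distance is bounded by 1, which is integrable on a probability
  space. Dominated convergence thus carries a.e. convergence of the partial sums over to the
  distance, and distance zero determines the class. Sums of classes can from here on be computed
  pointwise.\<close>

lemma L0_sums_iff:
  assumes "prob_space M" and F: "\<And>n. F n \<in> L0 M" and s: "s \<in> borel_measurable M"
    and sums: "AE x in M. (\<lambda>n. L0_rep (F n) x) sums s x"
  shows "L0_sums M F S \<longleftrightarrow> S = ae_class M s"
proof -
  interpret prob_space M by fact
  note [measurable] = s
  have [measurable]: "L0_rep (F n) \<in> borel_measurable M" for n using F by measurable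
  have *: "(\<lambda>n. L0_dist M (L0_partial_sum M F n) S) \<longlonglongrightarrow> (\<integral>x. min \<bar>s x - L0_rep S x\<bar> 1 \<partial>M)"
    if S: "S \<in> L0 M"
  proof -
    have [measurable]: "L0_rep S \<in> borel_measurable M" using S by measurable
    have "L0_dist M (L0_partial_sum M F n) S = (\<integral>x. min \<bar>(\<Sum>i<n. L0_rep (F i) x) - L0_rep S x\<bar> 1 \<partial>M)" for n
    proof -
      have P: "ae_class M (\<lambda>x. \<Sum>i<n. L0_rep (F i) x) \<in> L0 M" by (intro ae_class_in_L0) measurable
      have [measurable]: "L0_rep (ae_class M (\<lambda>x. \<Sum>i<n. L0_rep (F i) x)) \<in> borel_measurable M"
        using P by measurable
      have "AE x in M. L0_rep (ae_class M (\<lambda>x. \<Sum>i<n. L0_rep (F i) x)) x = (\<Sum>i<n. L0_rep (F i) x)"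
        by (intro AE_L0_rep) measurable
      then show ?thesis
        unfolding L0_dist_def L0_partial_sum_def by (intro integral_cong_AE) (measurable, auto)
    qed
    moreover have "(\<lambda>n. \<integral>x. min \<bar>(\<Sum>i<n. L0_rep (F i) x) - L0_rep S x\<bar> 1 \<partial>M) \<longlonglongrightarrow>
        (\<integral>x. min \<bar>s x - L0_rep S x\<bar> 1 \<partial>M)"
    proof (rule integral_dominated_convergence[where w="\<lambda>_. 1"])
      show "AE x in M. (\<lambda>n. min \<bar>(\<Sum>i<n. L0_rep (F i) x) - L0_rep S x\<bar> 1) \<longlonglongrightarrow> min \<bar>s x - L0_rep S x\<bar> 1"
        using sums by eventually_elim (auto simp: sums_def intro!: tendsto_intros)
    qed auto
    ultimately show ?thesis by simp
  qed
  show ?thesis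
  proof
    assume L: "L0_sums M F S"
    then have S: "S \<in> L0 M" and lim: "(\<lambda>n. L0_dist M (L0_partial_sum M F n) S) \<longlonglongrightarrow> 0"
      by (auto simp: L0_sums_def)
    have [measurable]: "L0_rep S \<in> borel_measurable M" using S by measurable
    have "(\<integral>x. min \<bar>s x - L0_rep S x\<bar> 1 \<partial>M) = 0" using LIMSEQ_unique[OF *[OF S] lim] .
    moreover have "integrable M (\<lambda>x. min \<bar>s x - L0_rep S x\<bar> 1)"
      by (rule integrable_const_bound[of _ 1]) auto
    ultimately have "AE x in M. min \<bar>s x - L0_rep S x\<bar> 1 = 0"
      by (subst (asm) integral_nonneg_eq_0_iff_AE) auto
    then have "AE x in M. s x = L0_rep S x" by eventually_elim (auto simp: min_def split: if_splits)
    then show "S = ae_class M s" using ae_class_cong[of s "L0_rep S" M] ae_class_L0_rep[OF S] by simp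
  next
    assume S: "S = ae_class M s"
    then have S': "S \<in> L0 M" using ae_class_in_L0[OF s] by simp
    have [measurable]: "L0_rep S \<in> borel_measurable M" using S' by measurable
    have "(\<integral>x. min \<bar>s x - L0_rep S x\<bar> 1 \<partial>M) = (\<integral>x. 0 \<partial>M)"
      using AE_L0_rep[OF s] unfolding S by (intro integral_cong_AE) (auto simp: S[symmetric])
    then show "L0_sums M F S" using *[OF S'] S' by (simp add: L0_sums_def)
  qed
qed

text \<open>Exhaustion: some countable subfamily has a union of maximal measure, because the
  countable subfamilies of a maximising sequence can be merged into one. Adding a further
  \<open>A i\<close> cannot increase the measure, so it contributes only a null set.\<close>

lemma (in finite_measure) ex_countable_essential_union:
  assumes A: "\<And>i. i \<in> I \<Longrightarrow> A i \<in> sets M"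
  shows "\<exists>J. countable J \<and> J \<subseteq> I \<and> (\<forall>i\<in>I. A i - (\<Union>j\<in>J. A j) \<in> null_sets M)"
proof -
  define \<J> where "\<J> = {J. countable J \<and> J \<subseteq> I}"
  define m where "m J = measure M (\<Union>j\<in>J. A j)" for J
  have bdd: "bdd_above (m ` \<J>)" unfolding m_def by (intro bdd_aboveI2[where M="measure M (space M)"] bounded_measure)
  have ne: "{} \<in> \<J>" by (simp add: \<J>_def)
  have meas: "(\<Union>j\<in>J. A j) \<in> sets M" if "J \<in> \<J>" for J
    using that A by (intro sets.countable_UN') (auto simp: \<J>_def)
  have "\<exists>J\<in>\<J>. (SUP J\<in>\<J>. m J) - inverse (real (Suc n)) < m J" for n
  proof -
    have "(SUP J\<in>\<J>. m J) - inverse (real (Suc n)) < (SUP J\<in>\<J>. m J)"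
      by (simp del: of_nat_Suc)
    then show ?thesis using ne bdd by (subst (asm) less_cSUP_iff) auto
  qed
  then obtain J where J: "\<And>n. J n \<in> \<J>" "\<And>n. (SUP J\<in>\<J>. m J) - inverse (real (Suc n)) < m (J n)"
    by metis
  define K where "K = (\<Union>n. J n)"
  have K: "K \<in> \<J>" using J(1) unfolding K_def \<J>_def by auto
  have "(SUP J\<in>\<J>. m J) \<le> m K"
  proof (rule field_le_epsilon)
    fix e :: real assume "0 < e"
    then obtain n where n: "inverse (real (Suc n)) < e" using reals_Archimedean by blast
    have "m (J n) \<le> m K"
      unfolding m_def using meas[OF K] by (intro finite_measure_mono) (auto simp: K_def)
    then show "(SUP J\<in>\<J>. m J) \<le> m K + e" using J(2)[of n] n by linarith
  qed
  then have max: "m L \<le> m K" if "L \<in> \<J>" for L using cSUP_upper[OF that bdd] by linarith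
  have "A i - (\<Union>j\<in>K. A j) \<in> null_sets M" if i: "i \<in> I" for i
  proof -
    have "insert i K \<in> \<J>" using K i by (auto simp: \<J>_def)
    from max[OF this] have "measure M (A i \<union> (\<Union>j\<in>K. A j)) \<le> measure M (\<Union>j\<in>K. A j)"
      by (simp add: m_def)
    moreover have "measure M (A i \<union> (\<Union>j\<in>K. A j)) = measure M (\<Union>j\<in>K. A j) + measure M (A i - (\<Union>j\<in>K. A j))"
      using finite_measure_Union'[OF meas[OF K] A[OF i]] by (simp add: Un_commute)
    ultimately have "measure M (A i - (\<Union>j\<in>K. A j)) = 0"
      using measure_nonneg[of M "A i - (\<Union>j\<in>K. A j)"] by linarith
    then show ?thesis using A[OF i] meas[OF K] by (simp add: null_sets_def emeasure_eq_measure)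
  qed
  then show ?thesis using K by (auto simp: \<J>_def)
qed

text \<open>
  A set of classes has a supremum: for each rational \<open>q\<close>, countably many members \<open>F\<close> suffice to
  cover, up to null sets, all the sets \<open>{F > q}\<close>; take the pointwise supremum of all of these.
\<close>

lemma ex_L0_bar_lub:
  assumes "prob_space M" and S: "\<S> \<subseteq> L0 M"
  shows "\<exists>T. is_lub (L0_bar M) T \<S>"
proof -
  interpret prob_space M by fact
  have rep [measurable]: "L0_rep F \<in> borel_measurable M" if "F \<in> \<S>" for F
    using S that L0_rep_measurable by blast
  define E where "E q F = {x\<in>space M. ereal (of_rat q) < L0_rep F x}" for q F
  have "\<exists>J. countable J \<and> J \<subseteq> \<S> \<and> (\<forall>F\<in>\<S>. E q F - (\<Union>F\<in>J. E q F) \<in> null_sets M)" for q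
    by (rule ex_countable_essential_union) (use rep in \<open>unfold E_def, measurable\<close>)
  then obtain J where J: "\<And>q. countable (J q) \<and> J q \<subseteq> \<S> \<and> (\<forall>F\<in>\<S>. E q F - (\<Union>F\<in>J q. E q F) \<in> null_sets M)"
    by metis
  define K where "K = (\<Union>q. J q)"
  have K: "countable K" "K \<subseteq> \<S>" using J unfolding K_def by auto
  define t where "t x = (SUP F\<in>K. L0_rep F x)" for x
  have t: "t \<in> borel_measurable M"
    unfolding t_def using K rep by (intro borel_measurable_SUP) auto
  have upper: "AE x in M. L0_rep F x \<le> t x" if F: "F \<in> \<S>" for F
  proof -
    \<comment> \<open>There are countably many rational thresholds, so their null sets can be
      discarded together; a failure of the bound would show at a rational strictly between the two
      values.\<close>
    have "AE x in M. \<forall>q. x \<notin> E q F - (\<Union>F\<in>J q. E q F)"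
      unfolding AE_all_countable using J F by (intro allI AE_not_in) blast
    then show ?thesis using AE_space
    proof eventually_elim
      case (elim x)
      show ?case
      proof (rule ccontr)
        assume "\<not> L0_rep F x \<le> t x"
        then obtain q :: rat where q: "t x < ereal (of_rat q)" "ereal (of_rat q) < L0_rep F x"
          using ereal_dense3[of "t x" "L0_rep F x"] by (auto simp: not_le)
        then obtain G where "G \<in> J q" "ereal (of_rat q) < L0_rep G x"
          using elim by (auto simp: E_def)
        moreover from this have "L0_rep G x \<le> t x" unfolding t_def K_def by (intro SUP_upper) auto
        ultimately show False using q by auto
      qed
    qed
  qed
  have "is_lub (L0_bar M) (ae_class M t) \<S>"
    unfolding least_def
  proof (intro conjI ballI)
    show "Upper (L0_bar M) \<S> \<subseteq> carrier (L0_bar M)" by (auto simp: Upper_def)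
    show "ae_class M t \<in> Upper (L0_bar M) \<S>"
    proof (rule Upper_memI)
      fix F assume F: "F \<in> \<S>"
      have "L0_le M (ae_class M (L0_rep F)) (ae_class M t)"
        using upper[OF F] rep[OF F] t by (simp add: L0_le_ae_class_iff)
      then show "F \<sqsubseteq>\<^bsub>L0_bar M\<^esub> ae_class M t"
        using F S by (simp add: L0_bar_def ae_class_L0_rep subset_iff)
    qed (simp add: L0_bar_def ae_class_in_L0 t)
    fix U assume "U \<in> Upper (L0_bar M) \<S>"
    then have U: "U \<in> L0 M" and le: "\<And>F. F \<in> \<S> \<Longrightarrow> L0_le M F U"
      using S by (auto simp: Upper_def L0_bar_def)
    have "AE x in M. \<forall>F\<in>K. L0_rep F x \<le> L0_rep U x"
      using le K by (intro AE_ball_countable[THEN iffD2]) (auto simp: L0_le_def)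
    then have "AE x in M. t x \<le> L0_rep U x"
      unfolding t_def by eventually_elim (auto intro: SUP_least)
    then have "L0_le M (ae_class M t) (ae_class M (L0_rep U))"
      using t L0_rep_measurable[OF U] by (simp add: L0_le_ae_class_iff)
    then show "ae_class M t \<sqsubseteq>\<^bsub>L0_bar M\<^esub> U" using U by (simp add: L0_bar_def ae_class_L0_rep)
  qed
  then show ?thesis ..
qed

text \<open>The lattice supremum is a Hilbert choice among least upper bounds, so it says something
  only once such a bound exists; antisymmetry on classes then identifies it.\<close>

lemma L0_bar_sup_eqI:
  assumes T: "is_lub (L0_bar M) T \<S>"
  shows "\<Squnion>\<^bsub>L0_bar M\<^esub> \<S> = T"
proof -
  have "is_lub (L0_bar M) (\<Squnion>\<^bsub>L0_bar M\<^esub> \<S>) \<S>"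
    unfolding Lattice.sup_def using T by (rule someI)
  then show ?thesis using T
    by (intro L0_le_antisym[of _ M]) (auto simp: least_def L0_bar_def)
qed

lemma L0_bar_sup_upper:
  assumes "prob_space M" "\<S> \<subseteq> L0 M" "F \<in> \<S>"
  shows "L0_le M F (\<Squnion>\<^bsub>L0_bar M\<^esub> \<S>)"
proof -
  obtain T where T: "is_lub (L0_bar M) T \<S>" using ex_L0_bar_lub[OF assms(1,2)] by blast
  then have "T \<in> Upper (L0_bar M) \<S>" by (simp add: least_def)
  then have "L0_le M F T" using assms(2,3) by (auto simp: Upper_def L0_bar_def)
  then show ?thesis using L0_bar_sup_eqI[OF T] by simp
qed

section \<open>Almost everywhere identities for \<open>L\<^sup>0\<close>-valued measures\<close>

lemma binaryset_in_borel_partitions: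
  assumes "A \<in> sets (borel_on \<Omega>)" "B \<in> sets (borel_on \<Omega>)" "A \<inter> B = {}"
  shows "binaryset A B \<in> borel_partitions \<Omega> (A \<union> B)"
  using assms by (auto simp: borel_partitions_def UN_binaryset_eq binaryset_def disjoint_family_on_def)

context
  fixes M :: "'x measure" and \<Omega> :: "'o::topological_space set" and \<mu> :: "'o set \<Rightarrow> ('x \<Rightarrow> real) set"
  assumes M: "prob_space M" and \<mu>: "L0_valued_measure M \<Omega> \<mu>"
begin

lemma L0_valued_measure_in_L0: "A \<in> sets (borel_on \<Omega>) \<Longrightarrow> \<mu> A \<in> L0 M"
  using \<mu> by (simp add: L0_valued_measure_def)

lemma AE_L0_valued_measure_empty: "AE x in M. L0_rep (\<mu> {}) x = 0"
  using \<mu> AE_L0_rep[of "\<lambda>_. 0 :: real" M] by (simp add: L0_valued_measure_def L0_zero_def)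

text \<open>Countable additivity in the distance becomes an a.e. statement. Arbitrary versions
  \<open>f n\<close> replace the chosen representatives, so that the values of a family of signed
  measures can be inserted.\<close>

lemma AE_L0_valued_measure_sums:
  assumes A: "range A \<subseteq> sets (borel_on \<Omega>)" "disjoint_family A"
    and f: "\<And>n. AE x in M. L0_rep (\<mu> (A n)) x = f n x"
    and s: "AE x in M. (\<lambda>n. f n x) sums s x" and sm: "s \<in> borel_measurable M"
  shows "AE x in M. L0_rep (\<mu> (\<Union>n. A n)) x = s x"
proof -
  have "AE x in M. \<forall>n. L0_rep (\<mu> (A n)) x = f n x" using f by (simp add: AE_all_countable)
  then have *: "AE x in M. (\<lambda>n. L0_rep (\<mu> (A n)) x) sums s x" using s by eventually_elim simp
  have "L0_sums M (\<lambda>n. \<mu> (A n)) (\<mu> (\<Union>n. A n))" using \<mu> A by (simp add: L0_valued_measure_def)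
  then have "\<mu> (\<Union>n. A n) = ae_class M s"
    using A by (subst (asm) L0_sums_iff[OF M _ sm *]) (auto intro: L0_valued_measure_in_L0)
  then show ?thesis using AE_L0_rep[OF sm] by simp
qed

lemma AE_L0_valued_measure_Un:
  assumes A: "A \<in> sets (borel_on \<Omega>)" and B: "B \<in> sets (borel_on \<Omega>)" and d: "A \<inter> B = {}"
  shows "AE x in M. L0_rep (\<mu> (A \<union> B)) x = L0_rep (\<mu> A) x + L0_rep (\<mu> B) x"
proof -
  have "AE x in M. L0_rep (\<mu> (\<Union>n. binaryset A B n)) x = L0_rep (\<mu> A) x + L0_rep (\<mu> B) x"
  proof (rule AE_L0_valued_measure_sums[where f="\<lambda>n x. L0_rep (\<mu> (binaryset A B n)) x"])
    \<comment> \<open>The pair is padded to a sequence by empty sets, and the representative of the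
      class at the empty set vanishes only almost everywhere.\<close>
    show "AE x in M. (\<lambda>n. L0_rep (\<mu> (binaryset A B n)) x) sums (L0_rep (\<mu> A) x + L0_rep (\<mu> B) x)"
      using AE_L0_valued_measure_empty
    proof eventually_elim
      case (elim x)
      show ?case using binaryset_sums[of "\<lambda>A. L0_rep (\<mu> A) x" A B] elim by simp
    qed
    show "(\<lambda>x. L0_rep (\<mu> A) x + L0_rep (\<mu> B) x) \<in> borel_measurable M"
      by (intro borel_measurable_add L0_rep_measurable L0_valued_measure_in_L0 A B)
  qed (use A B d in \<open>auto simp: binaryset_def disjoint_family_on_def\<close>)
  then show ?thesis by (simp add: UN_binaryset_eq)
qed

lemma L0_sums_abs_iff:
  assumes P: "range P \<subseteq> sets (borel_on \<Omega>)" and s: "s \<in> borel_measurable M"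
    and sums: "AE x in M. (\<lambda>n. \<bar>L0_rep (\<mu> (P n)) x\<bar>) sums s x"
  shows "L0_sums M (\<lambda>n. L0_abs M (\<mu> (P n))) S \<longleftrightarrow> S = ae_class M s"
proof (rule L0_sums_iff[OF M _ s])
  have L: "\<mu> (P n) \<in> L0 M" for n using P by (auto intro: L0_valued_measure_in_L0)
  then show "L0_abs M (\<mu> (P n)) \<in> L0 M" for n by (rule L0_abs_in_L0)
  have "AE x in M. \<forall>n. L0_rep (L0_abs M (\<mu> (P n))) x = \<bar>L0_rep (\<mu> (P n)) x\<bar>"
    using L by (simp add: AE_all_countable AE_L0_rep_abs)
  then show "AE x in M. (\<lambda>n. L0_rep (L0_abs M (\<mu> (P n))) x) sums s x"
    using sums by eventually_elim simp
qed

lemma L0_sums_abs_binary: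
  assumes A: "A \<in> sets (borel_on \<Omega>)" and B: "B \<in> sets (borel_on \<Omega>)"
  shows "L0_sums M (\<lambda>n. L0_abs M (\<mu> (binaryset A B n)))
    (ae_class M (\<lambda>x. \<bar>L0_rep (\<mu> A) x\<bar> + \<bar>L0_rep (\<mu> B) x\<bar>))"
proof (subst L0_sums_abs_iff)
  show "(\<lambda>x. \<bar>L0_rep (\<mu> A) x\<bar> + \<bar>L0_rep (\<mu> B) x\<bar>) \<in> borel_measurable M"
    by (intro borel_measurable_add borel_measurable_abs L0_rep_measurable L0_valued_measure_in_L0 A B)
  show "AE x in M. (\<lambda>n. \<bar>L0_rep (\<mu> (binaryset A B n)) x\<bar>) sums (\<bar>L0_rep (\<mu> A) x\<bar> + \<bar>L0_rep (\<mu> B) x\<bar>)"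
    using AE_L0_valued_measure_empty
  proof eventually_elim
    case (elim x)
    show ?case using binaryset_sums[of "\<lambda>A. \<bar>L0_rep (\<mu> A) x\<bar>" A B] elim by simp
  qed
qed (use A B in \<open>auto simp: binaryset_def\<close>)

text \<open>The partition of \<open>\<Omega>\<close> into \<open>A\<close> and
  \<open>\<Omega> - A\<close> takes part in the supremum, so the class of
  \<open>\<bar>\<mu> A\<bar>\<close> lies below the total variation of \<open>\<Omega>\<close>,
  which is real-valued by assumption. \<open>V\<close> is the same for all \<open>A\<close>; the
  exceptional null set is not.\<close>

lemma L0_valued_measure_dominated:
  assumes "L0_bounded_variation M \<Omega> \<mu>"
  shows "\<exists>V\<in>borel_measurable M. \<forall>A\<in>sets (borel_on \<Omega>). AE x in M. \<bar>L0_rep (\<mu> A) x\<bar> \<le> V x"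
proof -
  define \<S> where "\<S> = {L0_to_bar M S | S. \<exists>P\<in>borel_partitions \<Omega> \<Omega>. L0_sums M (\<lambda>n. L0_abs M (\<mu> (P n))) S}"
  obtain G where G: "G \<in> L0 M" "\<Squnion>\<^bsub>L0_bar M\<^esub> \<S> = L0_to_bar M G"
    using assms unfolding L0_bounded_variation_def L0_variation_bar_def \<S>_def L0_pos_def by blast
  have \<S>: "\<S> \<subseteq> L0 M" by (auto simp: \<S>_def L0_sums_def intro: L0_to_bar_in_L0)
  have "AE x in M. \<bar>L0_rep (\<mu> A) x\<bar> \<le> L0_rep G x" if A: "A \<in> sets (borel_on \<Omega>)" for A
  proof -
    have sp: "space (borel_on \<Omega>) = \<Omega>" by (simp add: space_restrict_space)
    have A': "\<Omega> - A \<in> sets (borel_on \<Omega>)" using sets.compl_sets[OF A] by (simp add: sp)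
    have *: "A \<union> (\<Omega> - A) = \<Omega>" using sets.sets_into_space[OF A] sp by auto
    define s where "s = (\<lambda>x. \<bar>L0_rep (\<mu> A) x\<bar> + \<bar>L0_rep (\<mu> (\<Omega> - A)) x\<bar>)"
    have s: "s \<in> borel_measurable M" unfolding s_def
      by (intro borel_measurable_add borel_measurable_abs L0_rep_measurable L0_valued_measure_in_L0 A A')
    have "L0_to_bar M (ae_class M s) \<in> \<S>"
      using L0_sums_abs_binary[OF A A'] binaryset_in_borel_partitions[OF A A'] *
      unfolding \<S>_def s_def by auto
    then have "L0_le M (L0_to_bar M (ae_class M s)) (L0_to_bar M G)"
      using L0_bar_sup_upper[OF M \<S>] G(2) by metis
    then have "AE x in M. L0_rep (ae_class M s) x \<le> L0_rep G x"
      by (simp add: L0_to_bar_le_iff ae_class_in_L0 s G(1))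
    then show ?thesis using AE_L0_rep[OF s] by eventually_elim (simp add: s_def)
  qed
  then show ?thesis using L0_rep_measurable[OF G(1)] by blast
qed

end

section \<open>Approximation from a countable algebra\<close>

text \<open>The algebra consists of the preimages of cylinders under the coding. The left inverse
  exhibits each Borel set as the preimage of a measurable subset of Cantor space, so these preimages
  generate.\<close>

lemma ex_countable_generating_algebra:
  fixes \<Omega> :: "'o::metric_space set"
  assumes \<Omega>: "compact \<Omega>"
  shows "\<exists>\<A>. countable \<A> \<and> algebra \<Omega> \<A> \<and> sets (borel_on \<Omega>) = sigma_sets \<Omega> \<A>"
proof (cases "\<Omega> = {}")
  case True
  have "sets (borel_on \<Omega>) = {{}}"
    using True by (simp add: space_empty_iff[symmetric] space_restrict_space)
  then show ?thesis using True
    by (intro exI[of _ "{{}}"]) (simp add: sigma_sets_single algebra_iff_Un)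
next
  case False
  let ?N = "borel_on \<Omega>"
  obtain \<Phi> \<Psi> where \<Phi>: "\<Phi> \<in> measurable ?N cantor" and \<Psi>: "\<Psi> \<in> measurable cantor ?N"
    and inv: "\<And>x. x \<in> \<Omega> \<Longrightarrow> \<Psi> (\<Phi> x) = x"
    using ex_cantor_coding[OF \<Omega> False] by blast
  have sp: "space ?N = \<Omega>" by (simp add: space_restrict_space)
  define \<A> where "\<A> = {\<Phi> -` A \<inter> \<Omega> | A. A \<in> cylinders}"
  have "countable \<A>"
    unfolding \<A>_def Setcompr_eq_image by (intro countable_image countable_cylinders)
  moreover have "algebra \<Omega> \<A>"
    unfolding algebra_iff_Un
  proof (intro conjI ballI)
    show "{} \<in> \<A>" unfolding \<A>_def using cylinders.empty_sets by blast
    fix A assume "A \<in> \<A>"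
    then obtain A' where A': "A' \<in> cylinders" "A = \<Phi> -` A' \<inter> \<Omega>" unfolding \<A>_def by blast
    then have "\<Omega> - A = \<Phi> -` (UNIV - A') \<inter> \<Omega>" by auto
    then show "\<Omega> - A \<in> \<A>" unfolding \<A>_def using cylinders.compl_sets[OF A'(1)] by blast
    fix B assume "B \<in> \<A>"
    then obtain B' where B': "B' \<in> cylinders" "B = \<Phi> -` B' \<inter> \<Omega>" unfolding \<A>_def by blast
    then have "A \<union> B = \<Phi> -` (A' \<union> B') \<inter> \<Omega>" using A' by auto
    then show "A \<union> B \<in> \<A>" unfolding \<A>_def using cylinders.Un[OF A'(1) B'(1)] by blast
  qed (auto simp: \<A>_def)
  moreover have "sets ?N = sigma_sets \<Omega> \<A>"
  proof -
    have "sets ?N = {\<Phi> -` A \<inter> \<Omega> | A. A \<in> sets cantor}"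
    proof (intro equalityI subsetI)
      fix B assume B: "B \<in> sets ?N"
      have "\<Psi> -` B \<in> sets cantor" using measurable_sets[OF \<Psi> B] by simp
      moreover have "B = \<Phi> -` (\<Psi> -` B) \<inter> \<Omega>"
        using sets.sets_into_space[OF B] inv unfolding sp by auto
      ultimately show "B \<in> {\<Phi> -` A \<inter> \<Omega> | A. A \<in> sets cantor}" by blast
    next
      fix B assume "B \<in> {\<Phi> -` A \<inter> \<Omega> | A. A \<in> sets cantor}"
      then show "B \<in> sets ?N" using measurable_sets[OF \<Phi>] unfolding sp by blast
    qed
    also have "\<dots> = sigma_sets \<Omega> \<A>"
      unfolding sets_cantor \<A>_def by (rule sigma_sets_vimage_commute) simp
    finally show ?thesis .
  qed
  ultimately show ?thesis by blast
qed

text \<open>The sets that can be approximated to every accuracy form a sigma-algebra: complements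
  leave the symmetric difference unchanged, and a countable union is truncated before it is
  approximated term by term.\<close>

lemma algebra_approximation:
  assumes m: "finite_measure m" and \<A>: "algebra \<Omega> \<A>" and s: "sets m = sigma_sets \<Omega> \<A>"
    and Y: "Y \<in> sets m" and e: "0 < (e::real)"
  shows "\<exists>B\<in>\<A>. measure m ((Y - B) \<union> (B - Y)) < e"
proof -
  interpret finite_measure m by fact
  interpret \<A>: algebra \<Omega> \<A> by fact
  have sub: "A \<in> sets m" if "A \<in> \<A>" for A using that by (simp add: s)
  have into: "A \<subseteq> \<Omega>" if "A \<in> sigma_sets \<Omega> \<A>" for A
    using sigma_sets_into_sp[OF \<A>.space_closed that] .
  have "\<forall>e>0. \<exists>B\<in>\<A>. measure m ((Y - B) \<union> (B - Y)) < e"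
    using Y unfolding s
  proof (induction rule: sigma_sets.induct)
    case (Basic A)
    show ?case
    proof (intro allI impI)
      fix e :: real assume "0 < e"
      then show "\<exists>B\<in>\<A>. measure m ((A - B) \<union> (B - A)) < e" using Basic by (intro bexI[of _ A]) simp_all
    qed
  next
    case Empty
    show ?case
    proof (intro allI impI)
      fix e :: real assume "0 < e"
      then show "\<exists>B\<in>\<A>. measure m (({} - B) \<union> (B - {})) < e" by (intro bexI[of _ "{}"]) simp_all
    qed
  next
    case (Compl A)
    show ?case
    proof (intro allI impI)
      fix e :: real assume "0 < e"
      from Compl.IH[rule_format, OF this]
      obtain B where B: "B \<in> \<A>" "measure m ((A - B) \<union> (B - A)) < e" by (elim bexE)
      have "A \<subseteq> \<Omega>" "B \<subseteq> \<Omega>" using into Compl.hyps B \<A>.sets_into_space by simp_all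
      then have "((\<Omega> - A) - (\<Omega> - B)) \<union> ((\<Omega> - B) - (\<Omega> - A)) = (A - B) \<union> (B - A)" by auto
      then show "\<exists>B\<in>\<A>. measure m (((\<Omega> - A) - B) \<union> (B - (\<Omega> - A))) < e"
        using B by (intro bexI[of _ "\<Omega> - B"]) auto
    qed
  next
    case (Union A)
    have A [measurable]: "A i \<in> sets m" for i using Union.hyps by (simp add: s)
    show ?case
    proof (intro allI impI)
      fix e :: real assume e: "0 < e"
      have "(\<lambda>n. measure m (\<Union>i<n. A i)) \<longlonglongrightarrow> measure m (\<Union>n. \<Union>i<n. A i)"
      proof (rule finite_Lim_measure_incseq)
        show "incseq (\<lambda>n. \<Union>i<n. A i)" unfolding incseq_def by (intro allI impI UN_mono) auto
      qed auto
      also have "(\<Union>n. \<Union>i<n. A i) = (\<Union>i. A i)" by auto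
      finally have "\<forall>\<^sub>F n in sequentially. measure m (\<Union>i. A i) - e / 2 < measure m (\<Union>i<n. A i)"
        by (rule order_tendstoD) (use e in simp)
      then obtain n where n: "measure m (\<Union>i. A i) - e / 2 < measure m (\<Union>i<n. A i)"
        by (auto simp: eventually_sequentially)
      \<comment> \<open>The \<open>n\<close> approximations cost at most
        \<open>n * r \<le> e / 2\<close> in total; \<open>Suc n\<close> keeps the denominator
        positive for \<open>n = 0\<close>. Strictness of the final bound comes from the
        truncation.\<close>
      define r where "r = e / (2 * real (Suc n))"
      have r: "0 < r" using e by (simp add: r_def)
      have "\<forall>i. \<exists>B\<in>\<A>. measure m ((A i - B) \<union> (B - A i)) < r" using Union.IH r by simp
      then obtain B where B: "\<And>i. B i \<in> \<A>" and less: "\<And>i. measure m ((A i - B i) \<union> (B i - A i)) < r"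
        by metis
      have [measurable]: "B i \<in> sets m" for i using B sub by simp
      let ?B = "\<Union>i<n. B i" and ?U = "\<Union>i. A i" and ?V = "\<Union>i<n. A i"
      have "measure m ((?U - ?B) \<union> (?B - ?U)) \<le> measure m ((?U - ?V) \<union> (\<Union>i<n. (A i - B i) \<union> (B i - A i)))"
      proof (rule finite_measure_mono)
        show "(?U - ?B) \<union> (?B - ?U) \<subseteq> (?U - ?V) \<union> (\<Union>i<n. (A i - B i) \<union> (B i - A i))" by blast
      qed auto
      also have "\<dots> \<le> measure m (?U - ?V) + measure m (\<Union>i<n. (A i - B i) \<union> (B i - A i))"
        by (intro measure_Un_le) auto
      also have "measure m (?U - ?V) = measure m ?U - measure m ?V"
        by (intro finite_measure_Diff) auto
      also have "measure m (\<Union>i<n. (A i - B i) \<union> (B i - A i)) \<le> (\<Sum>i<n. measure m ((A i - B i) \<union> (B i - A i)))"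
        by (intro finite_measure_subadditive_finite) auto
      also have "\<dots> \<le> (\<Sum>i<n. r)" by (intro sum_mono less_imp_le[OF less])
      also have "\<dots> \<le> e / 2" using e by (simp add: r_def field_simps)
      finally have "measure m ((?U - ?B) \<union> (?B - ?U)) < e" using n by simp
      then show "\<exists>B\<in>\<A>. measure m ((?U - B) \<union> (B - ?U)) < e"
        using B by (intro bexI[of _ ?B] \<A>.finite_UN) auto
    qed
  qed
  then show ?thesis using e by blast
qed

text \<open>The Hahn set that attains the variation depends on \<open>\<nu>\<close>, whereas
  \<open>\<A>\<close> does not. Approximating it by members of \<open>\<A>\<close> gives a supremum
  over a family that can be the same for every \<open>x\<close> of a foliation.\<close>

lemma signed_variation_properties:
  assumes \<nu>: "finite_signed_measure \<Omega> \<nu>"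
    and \<A>: "algebra \<Omega> \<A>" "sets (borel_on \<Omega>) = sigma_sets \<Omega> \<A>"
  shows finite_signed_measure_variation: "finite_signed_measure \<Omega> (signed_variation \<Omega> \<nu>)"
    and bdd_above_signed_variation: "A \<in> sets (borel_on \<Omega>) \<Longrightarrow>
      bdd_above ((\<lambda>B. \<bar>\<nu> (A \<inter> B)\<bar> + \<bar>\<nu> (A - B)\<bar>) ` \<A>)"
    and signed_variation_eq_SUP: "A \<in> sets (borel_on \<Omega>) \<Longrightarrow>
      signed_variation \<Omega> \<nu> A = (SUP B\<in>\<A>. \<bar>\<nu> (A \<inter> B)\<bar> + \<bar>\<nu> (A - B)\<bar>)"
    and summable_partition: "A \<in> sets (borel_on \<Omega>) \<Longrightarrow> P \<in> borel_partitions \<Omega> A \<Longrightarrow> summable (\<lambda>n. \<bar>\<nu> (P n)\<bar>)"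
    and suminf_partition_le: "A \<in> sets (borel_on \<Omega>) \<Longrightarrow> P \<in> borel_partitions \<Omega> A \<Longrightarrow>
      (\<Sum>n. \<bar>\<nu> (P n)\<bar>) \<le> signed_variation \<Omega> \<nu> A"
proof -
  let ?N = "borel_on \<Omega>"
  obtain m Y where m: "finite_measure m" and s: "sets m = sets ?N" and Y: "Y \<in> sets ?N"
    and v: "\<forall>A\<in>sets ?N. signed_variation_ennreal \<Omega> \<nu> A = emeasure m A \<and>
       measure m A = \<nu> (A \<inter> Y) - \<nu> (A - Y) \<and> \<bar>\<nu> A\<bar> \<le> measure m A"
    using ex_variation_measure[OF \<nu>] by (elim exE conjE)
  interpret finite_measure m by fact
  have var: "signed_variation \<Omega> \<nu> A = measure m A" if "A \<in> sets ?N" for A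
    using v that by (simp add: signed_variation_def measure_def)
  have abs_le: "\<bar>\<nu> A\<bar> \<le> measure m A" if "A \<in> sets ?N" for A using v that by blast
  have sub: "B \<in> sets ?N" if "B \<in> \<A>" for B using that by (simp add: \<A>(2))
  show "finite_signed_measure \<Omega> (signed_variation \<Omega> \<nu>)"
    unfolding finite_signed_measure_def
  proof (intro conjI allI impI)
    fix A :: "nat \<Rightarrow> 'a set" assume A: "range A \<subseteq> sets ?N \<and> disjoint_family A"
    then have "(\<lambda>n. measure m (A n)) sums measure m (\<Union>n. A n)"
      by (intro finite_measure_UNION) (auto simp: s)
    moreover have "A n \<in> sets ?N" for n using A by auto
    ultimately show "(\<lambda>n. signed_variation \<Omega> \<nu> (A n)) sums signed_variation \<Omega> \<nu> (\<Union>n. A n)"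
      by (simp add: var)
  qed (simp add: var)
  {
    fix A P assume A: "A \<in> sets ?N" and P: "P \<in> borel_partitions \<Omega> A"
    have Pn: "P n \<in> sets ?N" for n using P by (auto simp: borel_partitions_def)
    have "(\<lambda>n. measure m (P n)) sums measure m (\<Union>n. P n)"
      using P by (intro finite_measure_UNION) (auto simp: s borel_partitions_def)
    then have sums: "(\<lambda>n. measure m (P n)) sums measure m A" using P by (simp add: borel_partitions_def)
    show sm: "summable (\<lambda>n. \<bar>\<nu> (P n)\<bar>)"
      by (rule summable_comparison_test'[of "\<lambda>n. measure m (P n)" 0])
        (use sums abs_le[OF Pn] in \<open>simp_all add: sums_iff\<close>)
    have "(\<Sum>n. \<bar>\<nu> (P n)\<bar>) \<le> (\<Sum>n. measure m (P n))"
      using sums by (intro suminf_le abs_le[OF Pn] sm) (simp add: sums_iff)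
    then show "(\<Sum>n. \<bar>\<nu> (P n)\<bar>) \<le> signed_variation \<Omega> \<nu> A" using sums A by (simp add: sums_iff var)
  }
  {
    fix A assume A: "A \<in> sets ?N"
    let ?g = "\<lambda>B. \<bar>\<nu> (A \<inter> B)\<bar> + \<bar>\<nu> (A - B)\<bar>"
    have le: "?g B \<le> measure m A" if B: "B \<in> \<A>" for B
    proof -
      have "?g B \<le> measure m (A \<inter> B) + measure m (A - B)"
        using A sub[OF B] by (intro add_mono abs_le) auto
      also have "\<dots> = measure m ((A \<inter> B) \<union> (A - B))"
        using A sub[OF B] by (intro finite_measure_Union[symmetric]) (auto simp: s)
      also have "(A \<inter> B) \<union> (A - B) = A" by auto
      finally show ?thesis .
    qed
    show bdd: "bdd_above (?g ` \<A>)" using le by (intro bdd_aboveI2) auto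
    have ne: "\<A> \<noteq> {}" using \<A>(1) by (auto simp: algebra_iff_Un)
    have "measure m A \<le> (SUP B\<in>\<A>. ?g B)"
    proof (rule field_le_epsilon)
      fix e :: real assume "0 < e"
      then obtain B where B: "B \<in> \<A>" and less: "measure m ((Y - B) \<union> (B - Y)) < e / 2"
        using algebra_approximation[OF m \<A>(1), of Y "e / 2"] s \<A>(2) Y by auto
      have Bs: "B \<in> sets ?N" using sub[OF B] .
      \<comment> \<open>The values of \<open>\<nu>\<close> on two sets differ by at most the
        \<open>m\<close>-mass of their symmetric difference. It is applied twice, to exchange
        \<open>Y\<close> for \<open>B\<close> in the intersection and in the difference, at a cost
        below \<open>e / 2\<close> each time.\<close>
      have diff: "\<nu> C \<le> \<nu> D + measure m ((Y - B) \<union> (B - Y))"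
        if C: "C \<in> sets ?N" and D: "D \<in> sets ?N" and CD: "(C - D) \<union> (D - C) \<subseteq> (Y - B) \<union> (B - Y)" for C D
      proof -
        have "\<nu> C - \<nu> D = \<nu> (C - D) - \<nu> (D - C)"
          using finite_signed_measure_Diff[OF \<nu> C D] finite_signed_measure_Diff[OF \<nu> D C] by (simp add: Int_commute)
        also have "\<dots> \<le> measure m (C - D) + measure m (D - C)"
          using abs_le[of "C - D"] abs_le[of "D - C"] C D by (simp add: sets.Diff)
        also have "\<dots> = measure m ((C - D) \<union> (D - C))"
          using C D by (intro finite_measure_Union[symmetric]) (auto simp: s)
        also have "\<dots> \<le> measure m ((Y - B) \<union> (B - Y))"
          using CD Y Bs by (intro finite_measure_mono) (auto simp: s)
        finally show ?thesis by simp
      qed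
      have "measure m A = \<nu> (A \<inter> Y) - \<nu> (A - Y)" using v A by blast
      also have "\<dots> \<le> (\<nu> (A \<inter> B) + e / 2) - (\<nu> (A - B) - e / 2)"
      proof (rule diff_mono)
        show "\<nu> (A \<inter> Y) \<le> \<nu> (A \<inter> B) + e / 2"
          using diff[of "A \<inter> Y" "A \<inter> B"] A Y Bs less by fastforce
        show "\<nu> (A - B) - e / 2 \<le> \<nu> (A - Y)"
          using diff[of "A - B" "A - Y"] A Y Bs less by fastforce
      qed
      also have "\<dots> \<le> ?g B + e" by simp
      also have "?g B \<le> (SUP B\<in>\<A>. ?g B)" using B bdd by (rule cSUP_upper)
      finally show "measure m A \<le> (SUP B\<in>\<A>. ?g B) + e" by simp
    qed
    moreover have "(SUP B\<in>\<A>. ?g B) \<le> measure m A" using ne le by (rule cSUP_least)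
    ultimately show "signed_variation \<Omega> \<nu> A = (SUP B\<in>\<A>. ?g B)" using A by (simp add: var)
  }
qed

section \<open>Foliations\<close>

lemma AE_foliation:
  assumes \<kappa>: "foliation M \<Omega> \<mu> \<kappa>" and A: "A \<in> sets (borel_on \<Omega>)"
  shows "AE x in M. L0_rep (\<mu> A) x = \<kappa> x A"
proof -
  have "(\<lambda>x. \<kappa> x A) \<in> borel_measurable (completion M)" "\<mu> A = ae_class M (\<lambda>x. \<kappa> x A)"
    using \<kappa> A by (auto simp: foliation_def)
  moreover from this(1) obtain g where g: "g \<in> borel_measurable M" "AE x in M. \<kappa> x A = g x"
    using completion_ex_borel_measurable_real by blast
  ultimately have "\<mu> A = ae_class M g" by (simp add: ae_class_cong)
  then show ?thesis using AE_L0_rep[OF g(1)] g(2) by auto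
qed

text \<open>Dynkin's argument on an intersection-stable generator; the complement step uses that the
  total masses agree, which holds because \<open>\<Omega>\<close> lies in the algebra.\<close>

lemma finite_signed_measure_eqI:
  assumes \<nu>: "finite_signed_measure \<Omega> \<nu>" and \<nu>': "finite_signed_measure \<Omega> \<nu>'"
    and \<A>: "algebra \<Omega> \<A>" "sets (borel_on \<Omega>) = sigma_sets \<Omega> \<A>"
    and eq: "\<And>A. A \<in> \<A> \<Longrightarrow> \<nu> A = \<nu>' A" and A: "A \<in> sets (borel_on \<Omega>)"
  shows "\<nu> A = \<nu>' A"
proof -
  interpret \<A>: algebra \<Omega> \<A> by fact
  have "Int_stable \<A>" by (auto simp: Int_stable_def)
  moreover note \<A>.space_closed
  moreover have "A \<in> sigma_sets \<Omega> \<A>" using A \<A>(2) by simp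
  ultimately show ?thesis
  proof (induction rule: sigma_sets_induct_disjoint)
    case (basic A)
    then show ?case by (rule eq)
  next
    case empty
    then show ?case using finite_signed_measure_empty[OF \<nu>] finite_signed_measure_empty[OF \<nu>'] by simp
  next
    case (compl A)
    have A: "A \<in> sets (borel_on \<Omega>)" "\<Omega> \<in> sets (borel_on \<Omega>)" using compl \<A>.top by (auto simp: \<A>(2))
    have "\<Omega> \<inter> A = A" using sigma_sets_into_sp[OF \<A>.space_closed] compl by blast
    then show ?case
      using finite_signed_measure_Diff[OF \<nu> A(2,1)] finite_signed_measure_Diff[OF \<nu>' A(2,1)] compl eq[OF \<A>.top]
      by simp
  next
    case (union A)
    then have r: "range A \<subseteq> sets (borel_on \<Omega>)" by (simp add: \<A>(2))
    have "(\<lambda>i. \<nu> (A i)) sums \<nu> (\<Union>i. A i)" by (rule finite_signed_measure_sums[OF \<nu> r union(1)])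
    moreover have "(\<lambda>i. \<nu>' (A i)) sums \<nu>' (\<Union>i. A i)" by (rule finite_signed_measure_sums[OF \<nu>' r union(1)])
    ultimately show ?case using union(3) by (simp add: sums_iff)
  qed
qed

text \<open>Agreement on a countable generating algebra costs one null set, and at each remaining
  \<open>x\<close> it propagates to all Borel sets. The lemma serves both \<open>\<mu>\<close> and
  its variation.\<close>

lemma ae_unique_foliation:
  fixes \<Omega> :: "'o::metric_space set"
  assumes "compact \<Omega>"
  shows "ae_unique_foliation M \<Omega> \<mu>"
  unfolding ae_unique_foliation_def
proof (intro allI impI)
  fix \<kappa> \<kappa>' assume *: "foliation M \<Omega> \<mu> \<kappa> \<and> foliation M \<Omega> \<mu> \<kappa>'"
  obtain \<A> where \<A>: "countable \<A>" "algebra \<Omega> \<A>" "sets (borel_on \<Omega>) = sigma_sets \<Omega> \<A>"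
    using ex_countable_generating_algebra[OF assms] by blast
  have "AE x in M. \<kappa> x A = \<kappa>' x A" if "A \<in> \<A>" for A
  proof -
    have "A \<in> sets (borel_on \<Omega>)" using that by (simp add: \<A>(3))
    then show ?thesis using AE_foliation[of M \<Omega> \<mu> \<kappa> A] AE_foliation[of M \<Omega> \<mu> \<kappa>' A] * by auto
  qed
  then have "AE x in M. \<forall>A\<in>\<A>. \<kappa> x A = \<kappa>' x A" using \<A>(1) by (simp add: AE_ball_countable)
  then show "AE x in M. \<forall>A\<in>sets (borel_on \<Omega>). \<kappa> x A = \<kappa>' x A"
    using AE_space
  proof eventually_elim
    case (elim x)
    then have fsm: "finite_signed_measure \<Omega> (\<kappa> x)" "finite_signed_measure \<Omega> (\<kappa>' x)"
      using * by (auto simp: foliation_def)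
    show ?case by (rule ballI) (rule finite_signed_measure_eqI[OF fsm \<A>(2,3) elim(1)[rule_format]])
  qed
qed

section \<open>The foliation of the total variation\<close>

lemma L0_to_bar_ae_class:
  assumes "s \<in> borel_measurable M"
  shows "L0_to_bar M (ae_class M s) = ae_class M (\<lambda>x. ereal (s x))"
  unfolding L0_to_bar_def using AE_L0_rep[OF assms] by (intro ae_class_cong) auto

lemma L0_of_bar_ereal:
  assumes "s \<in> borel_measurable M"
  shows "L0_of_bar M (ae_class M (\<lambda>x. ereal (s x))) = ae_class M s"
proof -
  have "AE x in M. L0_rep (ae_class M (\<lambda>x. ereal (s x))) x = ereal (s x)"
    using assms by (intro AE_L0_rep) auto
  then show ?thesis unfolding L0_of_bar_def by (intro ae_class_cong) auto
qed

text \<open>Although uncountably many partitions enter the supremum, the upper bound is tested on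
  one at a time, with a null set that may depend on it. Minimality is tested on the two-set
  partitions cut by members of the countable \<open>\<A>\<close>, whose null sets can be
  united.\<close>

lemma L0_variation_bar_foliation:
  fixes M :: "'x measure"
  assumes M: "prob_space M" and \<mu>: "L0_valued_measure M \<Omega> \<mu>" and \<kappa>: "foliation M \<Omega> \<mu> \<kappa>"
    and \<A>: "countable \<A>" "algebra \<Omega> \<A>" "sets (borel_on \<Omega>) = sigma_sets \<Omega> \<A>"
    and A: "A \<in> sets (borel_on \<Omega>)"
    and v: "v \<in> borel_measurable M" "AE x in M. signed_variation \<Omega> (\<kappa> x) A = v x"
  shows "L0_variation_bar M \<Omega> \<mu> A = ae_class M (\<lambda>x. ereal (v x))"
  unfolding L0_variation_bar_def
proof (rule L0_bar_sup_eqI)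
  let ?N = "borel_on \<Omega>"
  let ?S = "{L0_to_bar M S | S. \<exists>P\<in>borel_partitions \<Omega> A. L0_sums M (\<lambda>n. L0_abs M (\<mu> (P n))) S}"
  have fsm: "finite_signed_measure \<Omega> (\<kappa> x)" if "x \<in> space M" for x using \<kappa> that by (simp add: foliation_def)
  have in_L0: "?S \<subseteq> L0 M" by (auto simp: L0_sums_def intro: L0_to_bar_in_L0)
  have vm: "(\<lambda>x. ereal (v x)) \<in> borel_measurable M" using v(1) by simp
  have sub: "B \<in> sets ?N" if "B \<in> \<A>" for B using that by (simp add: \<A>(3))
  show "is_lub (L0_bar M) (ae_class M (\<lambda>x. ereal (v x))) ?S"
    unfolding least_def
  proof (intro conjI ballI)
    show "Upper (L0_bar M) ?S \<subseteq> carrier (L0_bar M)" by (auto simp: Upper_def)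
    show "ae_class M (\<lambda>x. ereal (v x)) \<in> Upper (L0_bar M) ?S"
    proof (rule Upper_memI)
      fix F assume "F \<in> ?S"
      then obtain S P where F: "F = L0_to_bar M S" and P: "P \<in> borel_partitions \<Omega> A"
        and S: "L0_sums M (\<lambda>n. L0_abs M (\<mu> (P n))) S" by blast
      have r: "range P \<subseteq> sets ?N" using P by (simp add: borel_partitions_def)
      have [measurable]: "L0_rep (\<mu> (P n)) \<in> borel_measurable M" for n
        using r by (intro L0_rep_measurable L0_valued_measure_in_L0[OF M \<mu>]) auto
      define s where "s x = (\<Sum>n. \<bar>L0_rep (\<mu> (P n)) x\<bar>)" for x
      have s: "s \<in> borel_measurable M" unfolding s_def by measurable
      have "AE x in M. \<forall>n. L0_rep (\<mu> (P n)) x = \<kappa> x (P n)"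
        using r by (subst AE_all_countable) (auto intro!: AE_foliation[OF \<kappa>])
      then have *: "AE x in M. (\<lambda>n. \<bar>L0_rep (\<mu> (P n)) x\<bar>) sums s x \<and> s x \<le> v x"
        using AE_space v(2)
      proof eventually_elim
        case (elim x)
        then show ?case
          using summable_partition[OF fsm \<A>(2,3) A P, of x] suminf_partition_le[OF fsm \<A>(2,3) A P, of x]
          by (simp add: s_def summable_sums)
      qed
      have "S = ae_class M s"
        using S * by (subst (asm) L0_sums_abs_iff[OF M \<mu> r s]) auto
      then have "F = ae_class M (\<lambda>x. ereal (s x))" by (simp add: F L0_to_bar_ae_class s)
      moreover have "L0_le M (ae_class M (\<lambda>x. ereal (s x))) (ae_class M (\<lambda>x. ereal (v x)))"
        using s v(1) * by (subst L0_le_ae_class_iff) auto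
      ultimately show "F \<sqsubseteq>\<^bsub>L0_bar M\<^esub> ae_class M (\<lambda>x. ereal (v x))" by (simp add: L0_bar_def)
    qed (use ae_class_in_L0[OF vm] in \<open>simp add: L0_bar_def\<close>)
    fix U assume "U \<in> Upper (L0_bar M) ?S"
    then have U: "U \<in> L0 M" and le: "\<And>F. F \<in> ?S \<Longrightarrow> L0_le M F U"
      using in_L0 unfolding Upper_def L0_bar_def by auto
    have "AE x in M. ereal (\<bar>\<kappa> x (A \<inter> B)\<bar> + \<bar>\<kappa> x (A - B)\<bar>) \<le> L0_rep U x" if B: "B \<in> \<A>" for B
    proof -
      have AB: "A \<inter> B \<in> sets ?N" "A - B \<in> sets ?N" using A sub[OF B] by auto
      define s where "s x = \<bar>L0_rep (\<mu> (A \<inter> B)) x\<bar> + \<bar>L0_rep (\<mu> (A - B)) x\<bar>" for x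
      have s: "s \<in> borel_measurable M" unfolding s_def
        by (intro borel_measurable_add borel_measurable_abs L0_rep_measurable L0_valued_measure_in_L0[OF M \<mu>] AB)
      have "binaryset (A \<inter> B) (A - B) \<in> borel_partitions \<Omega> ((A \<inter> B) \<union> (A - B))"
        by (rule binaryset_in_borel_partitions[OF AB]) auto
      moreover have "(A \<inter> B) \<union> (A - B) = A" by auto
      ultimately have P: "binaryset (A \<inter> B) (A - B) \<in> borel_partitions \<Omega> A" by simp
      have "L0_to_bar M (ae_class M s) \<in> ?S"
        using P L0_sums_abs_binary[OF M \<mu> AB] unfolding s_def by blast
      then have "L0_le M (ae_class M (\<lambda>x. ereal (s x))) U"
        using le by (simp add: L0_to_bar_ae_class s)
      then have "AE x in M. ereal (s x) \<le> L0_rep U x"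
        using L0_le_ae_class_iff[of "\<lambda>x. ereal (s x)" M "L0_rep U"] s L0_rep_measurable[OF U]
        by (simp add: ae_class_L0_rep[OF U])
      then show ?thesis
        using AE_foliation[OF \<kappa> AB(1)] AE_foliation[OF \<kappa> AB(2)] by eventually_elim (simp add: s_def)
    qed
    then have "AE x in M. \<forall>B\<in>\<A>. ereal (\<bar>\<kappa> x (A \<inter> B)\<bar> + \<bar>\<kappa> x (A - B)\<bar>) \<le> L0_rep U x"
      using \<A>(1) by (simp add: AE_ball_countable)
    then have "AE x in M. ereal (v x) \<le> L0_rep U x"
      using AE_space v(2)
    proof eventually_elim
      case (elim x)
      have ne: "\<A> \<noteq> {}" using \<A>(2) by (auto simp: algebra_iff_Un)
      show ?case
      \<comment> \<open>The supremum formula lives in the reals, while \<open>U\<close> is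
        extended-valued: a value of plus infinity is trivial, and minus infinity is excluded because
        \<open>\<A>\<close> is nonempty.\<close>
      proof (cases "L0_rep U x")
        case (real u)
        have "(SUP B\<in>\<A>. \<bar>\<kappa> x (A \<inter> B)\<bar> + \<bar>\<kappa> x (A - B)\<bar>) \<le> u"
          using elim(1) real by (intro cSUP_least ne) auto
        then show ?thesis using elim(3) signed_variation_eq_SUP[OF fsm[OF elim(2)] \<A>(2,3) A] real by simp
      next
        case MInf
        then show ?thesis using elim(1) ne by auto
      qed simp
    qed
    then have "L0_le M (ae_class M (\<lambda>x. ereal (v x))) (ae_class M (L0_rep U))"
      using vm L0_rep_measurable[OF U] by (simp add: L0_le_ae_class_iff)
    then show "ae_class M (\<lambda>x. ereal (v x)) \<sqsubseteq>\<^bsub>L0_bar M\<^esub> U" using U by (simp add: L0_bar_def ae_class_L0_rep)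
  qed
qed

text \<open>The variation is a supremum over uncountably many partitions, so its measurability in
  \<open>x\<close> rests on the formula over a countable algebra.\<close>

lemma foliation_variation:
  fixes M :: "'x measure" and \<Omega> :: "'o::metric_space set"
  assumes M: "prob_space M" and \<Omega>: "compact \<Omega>" and \<mu>: "L0_valued_measure M \<Omega> \<mu>"
    and \<kappa>: "foliation M \<Omega> \<mu> \<kappa>"
  shows "foliation M \<Omega> (L0_variation M \<Omega> \<mu>) (\<lambda>x. signed_variation \<Omega> (\<kappa> x))"
proof -
  obtain \<A> where \<A>: "countable \<A>" "algebra \<Omega> \<A>" "sets (borel_on \<Omega>) = sigma_sets \<Omega> \<A>"
    using ex_countable_generating_algebra[OF \<Omega>] by blast
  have fsm: "finite_signed_measure \<Omega> (\<kappa> x)" if "x \<in> space M" for x using \<kappa> that by (simp add: foliation_def)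
  have km: "(\<lambda>x. \<kappa> x A) \<in> borel_measurable (completion M)" if "A \<in> sets (borel_on \<Omega>)" for A
    using \<kappa> that by (simp add: foliation_def)
  show ?thesis
    unfolding foliation_def
  proof (intro conjI ballI)
    fix A assume A: "A \<in> sets (borel_on \<Omega>)"
    have "(\<lambda>x. SUP B\<in>\<A>. \<bar>\<kappa> x (A \<inter> B)\<bar> + \<bar>\<kappa> x (A - B)\<bar>) \<in> borel_measurable (completion M)"
    proof (rule borel_measurable_cSUP[OF \<A>(1)])
      fix B assume "B \<in> \<A>"
      then have "B \<in> sets (borel_on \<Omega>)" by (simp add: \<A>(3))
      then have "A \<inter> B \<in> sets (borel_on \<Omega>)" "A - B \<in> sets (borel_on \<Omega>)" using A by auto
      then show "(\<lambda>x. \<bar>\<kappa> x (A \<inter> B)\<bar> + \<bar>\<kappa> x (A - B)\<bar>) \<in> borel_measurable (completion M)"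
        by (intro borel_measurable_add borel_measurable_abs km)
    next
      fix x assume "x \<in> space (completion M)"
      then show "bdd_above ((\<lambda>B. \<bar>\<kappa> x (A \<inter> B)\<bar> + \<bar>\<kappa> x (A - B)\<bar>) ` \<A>)"
        by (intro bdd_above_signed_variation[OF fsm \<A>(2,3) A]) simp
    qed
    then show m: "(\<lambda>x. signed_variation \<Omega> (\<kappa> x) A) \<in> borel_measurable (completion M)"
      by (subst measurable_cong[where g="\<lambda>x. SUP B\<in>\<A>. \<bar>\<kappa> x (A \<inter> B)\<bar> + \<bar>\<kappa> x (A - B)\<bar>"])
        (simp_all add: signed_variation_eq_SUP[OF fsm \<A>(2,3) A])
    obtain v where v: "v \<in> borel_measurable M" "AE x in M. signed_variation \<Omega> (\<kappa> x) A = v x"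
      using completion_ex_borel_measurable_real[OF m] by blast
    have "L0_variation M \<Omega> \<mu> A = ae_class M v"
      unfolding L0_variation_def L0_variation_bar_foliation[OF M \<mu> \<kappa> \<A> A v] by (rule L0_of_bar_ereal[OF v(1)])
    also have "\<dots> = ae_class M (\<lambda>x. signed_variation \<Omega> (\<kappa> x) A)"
      using v(2) by (intro ae_class_cong) auto
    finally show "L0_variation M \<Omega> \<mu> A = ae_class M (\<lambda>x. signed_variation \<Omega> (\<kappa> x) A)" .
  qed (rule finite_signed_measure_variation[OF fsm \<A>(2,3)])
qed

section \<open>Existence of a foliation\<close>

lemma ex_foliation:
  fixes M :: "'x measure" and \<Omega> :: "'o::metric_space set"
  assumes M: "prob_space M" and \<Omega>: "compact \<Omega>" "\<Omega> \<noteq> {}" and \<mu>: "L0_valued_measure M \<Omega> \<mu>"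
    and bv: "L0_bounded_variation M \<Omega> \<mu>"
  shows "\<exists>\<kappa>. foliation M \<Omega> \<mu> \<kappa>"
proof -
  let ?N = "borel_on \<Omega>"
  obtain \<Phi> \<Psi> where \<Phi>: "\<Phi> \<in> measurable ?N cantor" and \<Psi>: "\<Psi> \<in> measurable cantor ?N"
    and inv: "\<And>x. x \<in> \<Omega> \<Longrightarrow> \<Psi> (\<Phi> x) = x"
    using ex_cantor_coding[OF \<Omega>] by blast
  have sp: "space ?N = \<Omega>" by (simp add: space_restrict_space)
  \<comment> \<open>Representatives of the image of \<open>\<mu>\<close> under
    \<open>\<Phi>\<close>.\<close>
  define f where "f C x = L0_rep (\<mu> (\<Phi> -` C \<inter> \<Omega>)) x" for C x
  have pre: "\<Phi> -` C \<inter> \<Omega> \<in> sets ?N" if "C \<in> sets cantor" for C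
    using measurable_sets[OF \<Phi> that] by (simp add: sp)
  have cyl: "C \<in> sets cantor" if "C \<in> cylinders" for C using that by (rule cylinders_subset_sets_cantor)
  have f_meas: "f C \<in> borel_measurable M" if "C \<in> sets cantor" for C
    using L0_rep_measurable[OF L0_valued_measure_in_L0[OF M \<mu> pre[OF that]]] by (simp add: f_def[abs_def])
  have f_add: "AE x in M. f (C \<union> D) x = f C x + f D x"
    if CD: "C \<in> sets cantor" "D \<in> sets cantor" "C \<inter> D = {}" for C D
  proof -
    have "\<Phi> -` (C \<union> D) \<inter> \<Omega> = (\<Phi> -` C \<inter> \<Omega>) \<union> (\<Phi> -` D \<inter> \<Omega>)" by auto
    moreover have "(\<Phi> -` C \<inter> \<Omega>) \<inter> (\<Phi> -` D \<inter> \<Omega>) = {}" using CD(3) by auto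
    ultimately show ?thesis
      unfolding f_def using AE_L0_valued_measure_Un[OF M \<mu> pre[OF CD(1)] pre[OF CD(2)]] by simp
  qed
  obtain V where V: "\<And>A. A \<in> sets ?N \<Longrightarrow> AE x in M. \<bar>L0_rep (\<mu> A) x\<bar> \<le> V x"
    using L0_valued_measure_dominated[OF M \<mu> bv] by blast
  define good where "good x \<longleftrightarrow> (\<forall>C\<in>cylinders. \<bar>f C x\<bar> \<le> V x) \<and>
      (\<forall>C\<in>cylinders. \<forall>D\<in>cylinders. C \<inter> D = {} \<longrightarrow> f (C \<union> D) x = f C x + f D x)" for x
  have "AE x in M. \<bar>f C x\<bar> \<le> V x" if "C \<in> cylinders" for C
    unfolding f_def by (rule V[OF pre[OF cyl[OF that]]])
  then have "AE x in M. \<forall>C\<in>cylinders. \<bar>f C x\<bar> \<le> V x"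
    using countable_cylinders by (simp add: AE_ball_countable)
  moreover have "AE x in M. \<forall>C\<in>cylinders. \<forall>D\<in>cylinders. C \<inter> D = {} \<longrightarrow> f (C \<union> D) x = f C x + f D x"
    using f_add cyl countable_cylinders by (simp add: AE_ball_countable AE_impI)
  ultimately have ae: "AE x in M. good x"
    by eventually_elim (simp add: good_def)
  \<comment> \<open>The bad points need not form a measurable set; a null set of \<open>M\<close>
    containing them lets the modification \<open>g\<close> stay measurable. Setting \<open>g\<close>
    to 0 there yields a bounded content at every point of the space, as a foliation
    requires.\<close>
  obtain Z where Z: "Z \<in> null_sets M" and Zgood: "{x\<in>space M. \<not> good x} \<subseteq> Z"
    using ae unfolding eventually_ae_filter by (elim bexE)
  have good: "good x" if "x \<in> space M" "x \<notin> Z" for x using Zgood that by auto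
  define g where "g C x = (if x \<in> Z then 0 else f C x)" for C x
  have g_meas: "g C \<in> borel_measurable M" if "C \<in> sets cantor" for C
    unfolding g_def using f_meas[OF that] null_setsD2[OF Z] by (intro measurable_If_set) auto
  have g_f: "AE x in M. f C x = g C x" for C
    using AE_not_in[OF Z] by eventually_elim (simp add: g_def)
  define J where "J x m1 m2 \<longleftrightarrow> finite_measure m1 \<and> finite_measure m2 \<and> sets m1 = sets cantor \<and>
    sets m2 = sets cantor \<and> (\<forall>C\<in>cylinders. g C x = measure m1 C - measure m2 C)" for x m1 m2
  have "\<exists>m1 m2. J x m1 m2" if x: "x \<in> space M" for x
    unfolding J_def
  proof (rule cylinder_content_Jordan)
    \<comment> \<open>\<open>V x\<close> may be negative on \<open>Z\<close>, where the content is
      zero; the absolute value is a valid bound everywhere.\<close>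
    show "bounded_content UNIV cylinders (\<lambda>C. g C x) \<bar>V x\<bar>"
      using good[OF x] by unfold_locales (auto simp: g_def good_def intro: order_trans[OF _ abs_ge_self])
  qed
  then obtain m1 m2 where J: "\<And>x. x \<in> space M \<Longrightarrow> J x (m1 x) (m2 x)" by metis
  have m1: "finite_measure (m1 x)" "sets (m1 x) = sets cantor"
    and m2: "finite_measure (m2 x)" "sets (m2 x) = sets cantor"
    and g_eq: "\<And>C. C \<in> cylinders \<Longrightarrow> g C x = measure (m1 x) C - measure (m2 x) C"
    if "x \<in> space M" for x
    using J[OF that] by (simp_all add: J_def)
  define \<nu> where "\<nu> x C = measure (m1 x) C - measure (m2 x) C" for x C
  have \<nu>_sums: "(\<lambda>n. \<nu> x (C n)) sums \<nu> x (\<Union>n. C n)"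
    if x: "x \<in> space M" and C: "range C \<subseteq> sets cantor" "disjoint_family C" for x C
    unfolding \<nu>_def using m1[OF x] m2[OF x] C
    by (intro sums_diff finite_measure.finite_measure_UNION) simp_all
  have \<nu>_compl: "\<nu> x (UNIV - C) = \<nu> x UNIV - \<nu> x C" if x: "x \<in> space M" and C: "C \<in> sets cantor" for x C
  proof -
    have "space (m1 x) = UNIV" "space (m2 x) = UNIV"
      using sets_eq_imp_space_eq[OF m1(2)[OF x]] sets_eq_imp_space_eq[OF m2(2)[OF x]] by simp_all
    then show ?thesis unfolding \<nu>_def
      using finite_measure.finite_measure_compl[OF m1(1)[OF x], of C] finite_measure.finite_measure_compl[OF m2(1)[OF x], of C]
        m1(2)[OF x] m2(2)[OF x] C by simp
  qed
  \<comment> \<open>Measurability and agreement are proved in one induction: in the union step,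
    measurability of the limit is needed to identify its class.\<close>
  have main: "(\<lambda>x. \<nu> x C) \<in> borel_measurable M \<and> (AE x in M. f C x = \<nu> x C)" if C: "C \<in> sets cantor" for C
  proof -
    have "Int_stable cylinders" by (auto simp: Int_stable_def)
    moreover note cylinders.space_closed
    moreover have "C \<in> sigma_sets UNIV cylinders" using C by (simp add: sets_cantor)
    ultimately show ?thesis
    proof (induction rule: sigma_sets_induct_disjoint)
      case (basic C)
      have "(\<lambda>x. \<nu> x C) \<in> borel_measurable M \<longleftrightarrow> g C \<in> borel_measurable M"
        using g_eq[OF _ basic] by (intro measurable_cong) (simp add: \<nu>_def)
      moreover have "AE x in M. f C x = \<nu> x C"
        using g_f[of C] AE_space by eventually_elim (simp add: \<nu>_def g_eq basic)
      ultimately show ?case using g_meas[OF cyl[OF basic]] by simp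
    next
      case empty
      have "\<Phi> -` {} \<inter> \<Omega> = {}" by simp
      then show ?case using AE_L0_valued_measure_empty[OF M \<mu>] by (simp add: \<nu>_def f_def)
    next
      case (compl C)
      have C: "C \<in> sets cantor" "UNIV - C \<in> sets cantor" "UNIV \<in> cylinders"
        using compl(1) sets.compl_sets[of C cantor] cylinders.top by (simp_all add: sets_cantor)
      have U: "(\<lambda>x. \<nu> x UNIV) \<in> borel_measurable M" "AE x in M. f UNIV x = \<nu> x UNIV"
      proof -
        have "(\<lambda>x. \<nu> x UNIV) \<in> borel_measurable M \<longleftrightarrow> g UNIV \<in> borel_measurable M"
          using g_eq[OF _ C(3)] by (intro measurable_cong) (simp add: \<nu>_def)
        then show "(\<lambda>x. \<nu> x UNIV) \<in> borel_measurable M" using g_meas[OF cyl[OF C(3)]] by simp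
        show "AE x in M. f UNIV x = \<nu> x UNIV"
          using g_f[of UNIV] AE_space by eventually_elim (simp add: \<nu>_def g_eq C(3))
      qed
      have "(\<lambda>x. \<nu> x (UNIV - C)) \<in> borel_measurable M \<longleftrightarrow> (\<lambda>x. \<nu> x UNIV - \<nu> x C) \<in> borel_measurable M"
        by (intro measurable_cong \<nu>_compl C(1))
      moreover have "AE x in M. f (C \<union> (UNIV - C)) x = f C x + f (UNIV - C) x"
        by (intro f_add C) auto
      then have "AE x in M. f (UNIV - C) x = \<nu> x (UNIV - C)"
        using U(2) compl(2)[THEN conjunct2] AE_space
        by eventually_elim (simp add: \<nu>_compl C(1))
      ultimately show ?case using borel_measurable_diff[OF U(1)] compl(2) by simp
    next
      case (union C)
      have C: "range C \<subseteq> sets cantor" using union(2) by (simp add: sets_cantor)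
      have "(\<lambda>x. \<nu> x (\<Union>i. C i)) \<in> borel_measurable M \<longleftrightarrow> (\<lambda>x. \<Sum>i. \<nu> x (C i)) \<in> borel_measurable M"
        using \<nu>_sums[OF _ C union(1)] by (intro measurable_cong) (simp add: sums_iff)
      moreover have "(\<lambda>x. \<Sum>i. \<nu> x (C i)) \<in> borel_measurable M"
        using union(3) by (intro borel_measurable_suminf) simp
      ultimately have m: "(\<lambda>x. \<nu> x (\<Union>i. C i)) \<in> borel_measurable M" by simp
      have "AE x in M. L0_rep (\<mu> (\<Union>i. \<Phi> -` C i \<inter> \<Omega>)) x = \<nu> x (\<Union>i. C i)"
      proof (rule AE_L0_valued_measure_sums[OF M \<mu> _ _ _ _ m])
        show "range (\<lambda>i. \<Phi> -` C i \<inter> \<Omega>) \<subseteq> sets ?N" using C by (auto intro!: pre)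
        show "disjoint_family (\<lambda>i. \<Phi> -` C i \<inter> \<Omega>)" using union(1) by (fastforce simp: disjoint_family_on_def)
        show "AE x in M. L0_rep (\<mu> (\<Phi> -` C i \<inter> \<Omega>)) x = \<nu> x (C i)" for i
          using union(3)[of i] by (simp add: f_def)
        show "AE x in M. (\<lambda>i. \<nu> x (C i)) sums \<nu> x (\<Union>i. C i)"
          using AE_space by eventually_elim (rule \<nu>_sums[OF _ C union(1)])
      qed
      moreover have "(\<Union>i. \<Phi> -` C i \<inter> \<Omega>) = \<Phi> -` (\<Union>i. C i) \<inter> \<Omega>" by auto
      ultimately show ?case using m by (simp add: f_def)
    qed
  qed
  \<comment> \<open>The image under \<open>\<Psi>\<close> undoes the image under
    \<open>\<Phi>\<close>, because \<open>\<Psi>\<close> is a left inverse of \<open>\<Phi>\<close>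
    on \<open>\<Omega>\<close>.\<close>
  define \<kappa> where "\<kappa> x A = \<nu> x (\<Psi> -` A)" for x A
  have pre': "\<Psi> -` A \<in> sets cantor" if "A \<in> sets ?N" for A using measurable_sets[OF \<Psi> that] by simp
  have "foliation M \<Omega> \<mu> \<kappa>"
    unfolding foliation_def
  proof (intro conjI ballI)
    fix x assume x: "x \<in> space M"
    show "finite_signed_measure \<Omega> (\<kappa> x)"
      unfolding finite_signed_measure_def
    proof (intro conjI allI impI)
      fix A :: "nat \<Rightarrow> 'o set" assume A: "range A \<subseteq> sets ?N \<and> disjoint_family A"
      have "(\<lambda>n. \<nu> x (\<Psi> -` A n)) sums \<nu> x (\<Union>n. \<Psi> -` A n)"
      proof (rule \<nu>_sums[OF x])
        show "range (\<lambda>n. \<Psi> -` A n) \<subseteq> sets cantor" using A by (auto intro!: pre')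
        show "disjoint_family (\<lambda>n. \<Psi> -` A n)" using A by (fastforce simp: disjoint_family_on_def)
      qed
      then show "(\<lambda>n. \<kappa> x (A n)) sums \<kappa> x (\<Union>n. A n)" by (simp add: \<kappa>_def vimage_UN)
    qed (simp add: \<kappa>_def \<nu>_def)
  next
    fix A assume A: "A \<in> sets ?N"
    have m: "(\<lambda>x. \<kappa> x A) \<in> borel_measurable M" and ae: "AE x in M. f (\<Psi> -` A) x = \<kappa> x A"
      using main[OF pre'[OF A]] by (simp_all add: \<kappa>_def)
    show "(\<lambda>x. \<kappa> x A) \<in> borel_measurable (completion M)" using m by (rule measurable_completion)
    have "\<Phi> -` (\<Psi> -` A) \<inter> \<Omega> = A" using sets.sets_into_space[OF A] inv by (auto simp: sp)
    then have "AE x in M. L0_rep (\<mu> A) x = \<kappa> x A" using ae by (simp add: f_def)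
    then show "\<mu> A = ae_class M (\<lambda>x. \<kappa> x A)"
      using ae_class_cong ae_class_L0_rep[OF L0_valued_measure_in_L0[OF M \<mu> A]] by metis
  qed
  then show ?thesis by blast
qed

text \<open>The coding presupposes a point of \<open>\<Omega>\<close>. Over the empty space the
  empty set is the only Borel set, so the zero family is a foliation.\<close>

lemma foliation_empty:
  fixes \<mu> :: "'o::topological_space set \<Rightarrow> ('x \<Rightarrow> real) set"
  assumes "L0_valued_measure M {} \<mu>"
  shows "foliation M {} \<mu> (\<lambda>x A. 0)"
proof -
  have "sets (borel_on ({} :: 'o set)) = {{}}"
    by (simp add: space_empty_iff[symmetric] space_restrict_space)
  then show ?thesis
    using assms by (simp add: foliation_def finite_signed_measure_def L0_valued_measure_def L0_zero_def)
qed

theorem corollary5p22: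
  fixes M :: "'x measure"
    and \<Omega> :: "'o::metric_space set"
    and \<mu> :: "'o set \<Rightarrow> ('x \<Rightarrow> real) set"
  assumes "prob_space M"
    and "compact \<Omega>"
    and "\<mu> \<in> L0_Radon_measures M \<Omega>"
  shows "(\<exists>\<kappa>. foliation M \<Omega> \<mu> \<kappa> \<and> (\<forall>x\<in>space M. \<kappa> x \<in> Radon_measures \<Omega>)) \<and>
    ae_unique_foliation M \<Omega> \<mu> \<and>
    (\<forall>\<kappa>. foliation M \<Omega> \<mu> \<kappa> \<and> (\<forall>x\<in>space M. \<kappa> x \<in> Radon_measures \<Omega>) \<longrightarrow>
      foliation M \<Omega> (L0_variation M \<Omega> \<mu>) (\<lambda>x. signed_variation \<Omega> (\<kappa> x))) \<and>
    ae_unique_foliation M \<Omega> (L0_variation M \<Omega> \<mu>)"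
proof -
  have \<mu>: "L0_valued_measure M \<Omega> \<mu>" "L0_bounded_variation M \<Omega> \<mu>"
    using assms(3) by (simp_all add: L0_Radon_measures_def)
  obtain \<kappa> where \<kappa>: "foliation M \<Omega> \<mu> \<kappa>"
    using ex_foliation[OF assms(1,2) _ \<mu>] foliation_empty[of M \<mu>] \<mu>(1) by (cases "\<Omega> = {}") auto
  then have "\<forall>x\<in>space M. \<kappa> x \<in> Radon_measures \<Omega>"
    by (auto simp: foliation_def intro: finite_signed_measure_Radon[OF assms(2)])
  with \<kappa> show ?thesis
    using ae_unique_foliation[OF assms(2)] foliation_variation[OF assms(1,2) \<mu>(1)] by blast
qed

end
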